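(* Let $(X,\mathcal{A})$ be a $\mathbb{C}$-algebraized space, and let $\mathcal{F}$ and $\mathcal{E}$ be free $\mathcal{A}$-modules of finite rank, paired into $\mathcal{A}$ through a bilinear morphism $\Phi:\mathcal{F}\times\mathcal{E}\longrightarrow\mathcal{A}$. The following hold: (i) If $\Phi$ is non-degenerate, then $\mathcal{F}$ and $\mathcal{E}$ are $\mathcal{A}$-isomorphic. (ii) If $\Phi$ is degenerate, then $\mathcal{F}/\mathcal{E}^\perp$ and $\mathcal{E}/\mathcal{F}^\perp$ are paired into $\mathcal{A}$ through the $\mathcal{A}$-morphism $\overline{\Phi}:\mathcal{F}/\mathcal{E}^\perp\times\mathcal{E}/\mathcal{F}^\perp\longrightarrow\mathcal{A}$ given by $$\overline{\Phi}_U(\bar t,\bar s)=\Phi_U(t,s)$$ for all $t\in\mathcal{F}(U)$, $s\in\mathcal{E}(U)$, where $U$ is an arbitrary open subset of $X$. Moreover, $\overline{\Phi}$ is non-degenerate, i.e. $$(\mathcal{F}/\mathcal{E}^\perp)^\perp=0,\qquad (\mathcal{E}/\mathcal{F}^\perp)^\perp=0 .$$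
   Context: A $\mathbb{C}$-algebraized space $(X,\mathcal{A})$ is a topological space $X$ with a sheaf $\mathcal{A}$ of (unital commutative) $\mathbb{C}$-algebras on it. An $\mathcal{A}$-module is a sheaf of $\mathcal{A}$-modules on $X$; it is free of rank $n$ if it is $\mathcal{A}$-isomorphic to $\mathcal{A}^n$. $\mathcal{E}(U)=\Gamma(U,\mathcal{E})$. The quotient $\mathcal{E}/\mathcal{G}$ by a sub-$\mathcal{A}$-module is the sheaf generated by the presheaf $U\mapsto\mathcal{E}(U)/\mathcal{G}(U)$. A pairing of $\mathcal{F}$ and $\mathcal{E}$ into $\mathcal{A}$ is a bilinear $\mathcal{A}$-morphism $\Phi=(\Phi_U):\mathcal{F}\times\mathcal{E}\to\mathcal{A}$, i.e. each $\Phi_U:\mathcal{F}(U)\times\mathcal{E}(U)\to\mathcal{A}(U)$ is $\mathcal{A}(U)$-bilinear, compatibly with restrictions. Orthogonals: for open $U$, $\mathcal{E}(U)^\perp=\{t\in\mathcal{F}(U):\Phi_U(t,s)=0\text{ for all }s\in\mathcal{E}(U)\}$ and $\mathcal{F}(U)^\perp=\{s\in\mathcal{E}(U):\Phi_U(t,s)=0\text{ for all }t\in\mathcal{F}(U)\}$. $\mathcal{E}^\perp\subseteq\mathcal{F}$ (left kernel) and $\mathcal{F}^\perp\subseteq\mathcal{E}$ (right kernel) are the sub-$\mathcal{A}$-modules generated by the presheaves $U\mapsto\mathcal{E}(U)^\perp$ and $U\mapsto\mathcal{F}(U)^\perp$ (with the restricted restriction maps), and $\mathcal{E}^\perp(U)=\mathcal{E}(U)^\perp$,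 $\mathcal{F}^\perp(U)=\mathcal{F}(U)^\perp$. $\Phi$ is non-degenerate if $\mathcal{E}^\perp=\mathcal{F}^\perp=0$, and degenerate otherwise. The same definitions apply to the pairing $\overline{\Phi}$: $(\mathcal{F}/\mathcal{E}^\perp)^\perp\subseteq\mathcal{E}/\mathcal{F}^\perp$ and $(\mathcal{E}/\mathcal{F}^\perp)^\perp\subseteq\mathcal{F}/\mathcal{E}^\perp$ are the orthogonals with respect to $\overline{\Phi}$. Here $\bar t$ and $\bar s$ denote the classes of $t$ modulo $\mathcal{E}^\perp(U)$ and of $s$ modulo $\mathcal{F}^\perp(U)$; the sheaf morphism $\overline{\Phi}$ is the one induced by sheafifying the presheaf maps $\mathcal{F}(U)/\mathcal{E}^\perp(U)\times\mathcal{E}(U)/\mathcal{F}^\perp(U)\to\mathcal{A}(U)$, $(\bar t,\bar s)\mapsto\Phi_U(t,s)$. *)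

theory Defs
  imports "HOL-Analysis.Abstract_Topology" "HOL-Algebra.Algebraic_Closure_Type"
begin

text \<open>
  The structure \<open>'s\<close> on the sections over an open set (whose elements have type \<open>'a\<close>) is a
  HOL-Algebra record. Values of \<open>sec\<close> and \<open>res\<close> at sets that are not open are irrelevant.
\<close>

record ('x, 'a, 's) presheaf =
  sec :: "'x set \<Rightarrow> 's"
  res :: "'x set \<Rightarrow> 'x set \<Rightarrow> 'a \<Rightarrow> 'a"

type_synonym ('x, 'r) algebra_presheaf = "('x, 'r, (complex, 'r) module) presheaf"
type_synonym ('x, 'r, 'm) module_presheaf = "('x, 'm, ('r, 'm) module) presheaf"

locale set_presheaf =
  fixes T :: "'x topology" and P :: "('x, 'a, ('a, 'b) partial_object_scheme) presheaf"
  assumes res_closed: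
      "\<lbrakk>openin T U; openin T V; V \<subseteq> U; s \<in> carrier (sec P U)\<rbrakk> \<Longrightarrow> res P U V s \<in> carrier (sec P V)"
    and res_id: "\<lbrakk>openin T U; s \<in> carrier (sec P U)\<rbrakk> \<Longrightarrow> res P U U s = s"
    and res_comp:
      "\<lbrakk>openin T U; openin T V; openin T W; W \<subseteq> V; V \<subseteq> U; s \<in> carrier (sec P U)\<rbrakk>
        \<Longrightarrow> res P V W (res P U V s) = res P U W s"

text \<open>The empty covering of the empty set is included: there is exactly one section over \<open>{}\<close>.\<close>

locale set_sheaf = set_presheaf +
  assumes locality:
      "\<lbrakk>\<And>V. V \<in> \<C> \<Longrightarrow> openin T V; s \<in> carrier (sec P (\<Union>\<C>)); t \<in> carrier (sec P (\<Union>\<C>));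
        \<And>V. V \<in> \<C> \<Longrightarrow> res P (\<Union>\<C>) V s = res P (\<Union>\<C>) V t\<rbrakk> \<Longrightarrow> s = t"
    and gluing:
      "\<lbrakk>\<And>V. V \<in> \<C> \<Longrightarrow> openin T V; \<And>V. V \<in> \<C> \<Longrightarrow> f V \<in> carrier (sec P V);
        \<And>V W. \<lbrakk>V \<in> \<C>; W \<in> \<C>\<rbrakk> \<Longrightarrow> res P V (V \<inter> W) (f V) = res P W (V \<inter> W) (f W)\<rbrakk>
        \<Longrightarrow> \<exists>s\<in>carrier (sec P (\<Union>\<C>)). \<forall>V\<in>\<C>. res P (\<Union>\<C>) V s = f V"

locale algebraized_space = set_sheaf T A
  for T :: "'x topology" and A :: "('x, 'r) algebra_presheaf" +
  assumes sec_algebra: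
      "openin T U \<Longrightarrow> algebra (ring_of_type_algebra :: complex ring) (sec A U)"
    and res_ring_hom:
      "\<lbrakk>openin T U; openin T V; V \<subseteq> U\<rbrakk> \<Longrightarrow> res A U V \<in> ring_hom (sec A U) (sec A V)"
    and res_scalar:
      "\<lbrakk>openin T U; openin T V; V \<subseteq> U; a \<in> carrier (sec A U)\<rbrakk>
        \<Longrightarrow> res A U V (c \<odot>\<^bsub>sec A U\<^esub> a) = c \<odot>\<^bsub>sec A V\<^esub> res A U V a"

locale module_sheaf = base: algebraized_space T A + set_sheaf T M
  for T :: "'x topology" and A :: "('x, 'r) algebra_presheaf"
    and M :: "('x, 'r, 'm) module_presheaf" +
  assumes sec_module: "openin T U \<Longrightarrow> module (sec A U) (sec M U)"
    and res_add:
      "\<lbrakk>openin T U; openin T V; V \<subseteq> U; s \<in> carrier (sec M U); t \<in> carrier (sec M U)\<rbrakk>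
        \<Longrightarrow> res M U V (s \<oplus>\<^bsub>sec M U\<^esub> t) = res M U V s \<oplus>\<^bsub>sec M V\<^esub> res M U V t"
    and res_smult:
      "\<lbrakk>openin T U; openin T V; V \<subseteq> U; a \<in> carrier (sec A U); s \<in> carrier (sec M U)\<rbrakk>
        \<Longrightarrow> res M U V (a \<odot>\<^bsub>sec M U\<^esub> s) = res A U V a \<odot>\<^bsub>sec M V\<^esub> res M U V s"

definition sheaf_morphism ::
  "'x topology \<Rightarrow> ('x, 'r) algebra_presheaf \<Rightarrow> ('x, 'r, 'm) module_presheaf \<Rightarrow>
   ('x, 'r, 'n) module_presheaf \<Rightarrow> ('x set \<Rightarrow> 'm \<Rightarrow> 'n) \<Rightarrow> bool" where
  "sheaf_morphism T A M N \<phi> \<longleftrightarrow>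
    (\<forall>U. openin T U \<longrightarrow>
      \<phi> U \<in> carrier (sec M U) \<rightarrow> carrier (sec N U) \<and>
      (\<forall>s\<in>carrier (sec M U). \<forall>t\<in>carrier (sec M U).
        \<phi> U (s \<oplus>\<^bsub>sec M U\<^esub> t) = \<phi> U s \<oplus>\<^bsub>sec N U\<^esub> \<phi> U t) \<and>
      (\<forall>a\<in>carrier (sec A U). \<forall>s\<in>carrier (sec M U).
        \<phi> U (a \<odot>\<^bsub>sec M U\<^esub> s) = a \<odot>\<^bsub>sec N U\<^esub> \<phi> U s)) \<and>
    (\<forall>U V. openin T U \<longrightarrow> openin T V \<longrightarrow> V \<subseteq> U \<longrightarrow>
      (\<forall>s\<in>carrier (sec M U). \<phi> V (res M U V s) = res N U V (\<phi> U s)))"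

definition sheaf_isomorphic ::
  "'x topology \<Rightarrow> ('x, 'r) algebra_presheaf \<Rightarrow> ('x, 'r, 'm) module_presheaf \<Rightarrow>
   ('x, 'r, 'n) module_presheaf \<Rightarrow> bool" where
  "sheaf_isomorphic T A M N \<longleftrightarrow>
    (\<exists>\<phi> \<psi>. sheaf_morphism T A M N \<phi> \<and> sheaf_morphism T A N M \<psi> \<and>
      (\<forall>U. openin T U \<longrightarrow>
        (\<forall>s\<in>carrier (sec M U). \<psi> U (\<phi> U s) = s) \<and>
        (\<forall>t\<in>carrier (sec N U). \<phi> U (\<psi> U t) = t)))"

text \<open>
  The record of a module also has the fields \<open>mult\<close> and \<open>one\<close> of a ring, which play no role
  for modules and are left undefined in the constructions below.
\<close>

definition free_sheaf ::
  "('x, 'r) algebra_presheaf \<Rightarrow> nat \<Rightarrow> ('x, 'r, nat \<Rightarrow> 'r) module_presheaf" where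
  "free_sheaf A n =
    \<lparr>sec = (\<lambda>U. \<lparr>carrier = {..<n} \<rightarrow>\<^sub>E carrier (sec A U),
       monoid.mult = undefined, one = undefined,
       zero = (\<lambda>i\<in>{..<n}. \<zero>\<^bsub>sec A U\<^esub>),
       add = (\<lambda>f g. \<lambda>i\<in>{..<n}. f i \<oplus>\<^bsub>sec A U\<^esub> g i),
       module.smult = (\<lambda>a f. \<lambda>i\<in>{..<n}. a \<otimes>\<^bsub>sec A U\<^esub> f i)\<rparr>),
     res = (\<lambda>U V f. \<lambda>i\<in>{..<n}. res A U V (f i))\<rparr>"

definition free_of_rank ::
  "'x topology \<Rightarrow> ('x, 'r) algebra_presheaf \<Rightarrow> ('x, 'r, 'm) module_presheaf \<Rightarrow> nat \<Rightarrow> bool" where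
  "free_of_rank T A M n \<longleftrightarrow> module_sheaf T A M \<and> sheaf_isomorphic T A M (free_sheaf A n)"

text \<open>
  The sheaf generated by a presheaf: \<open>germ T P x U s\<close> is the germ at \<open>x\<close> of \<open>s \<in> P(U)\<close>, an
  equivalence class of pairs \<open>(V, t)\<close>, and a section over \<open>U\<close> is a function assigning to each
  point of \<open>U\<close> a germ there, locally given by sections of \<open>P\<close>. Operations are pointwise on the
  stalks. The union over representatives is a union of equal sets, as for \<^const>\<open>rcoset_mult\<close>.
\<close>

definition germ ::
  "'x topology \<Rightarrow> ('x, 'a, ('a, 'b) partial_object_scheme) presheaf \<Rightarrow> 'x \<Rightarrow> 'x set \<Rightarrow> 'a \<Rightarrow>
   ('x set \<times> 'a) set" where
  "germ T P x U s =
    {(V, t). openin T V \<and> x \<in> V \<and> t \<in> carrier (sec P V) \<and>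
      (\<exists>W. openin T W \<and> x \<in> W \<and> W \<subseteq> U \<inter> V \<and> res P U W s = res P V W t)}"

definition to_sheafification ::
  "'x topology \<Rightarrow> ('x, 'a, ('a, 'b) partial_object_scheme) presheaf \<Rightarrow> 'x set \<Rightarrow> 'a \<Rightarrow>
   'x \<Rightarrow> ('x set \<times> 'a) set" where
  "to_sheafification T P U s = (\<lambda>x\<in>U. germ T P x U s)"

definition sheafification ::
  "'x topology \<Rightarrow> ('x, 'r) algebra_presheaf \<Rightarrow> ('x, 'r, 'm) module_presheaf \<Rightarrow>
   ('x, 'r, 'x \<Rightarrow> ('x set \<times> 'm) set) module_presheaf" where
  "sheafification T A P =
    \<lparr>sec = (\<lambda>U. \<lparr>carrier = {\<sigma> \<in> extensional U. \<forall>x\<in>U. \<exists>V s. openin T V \<and> x \<in> V \<and> V \<subseteq> U \<and>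
           s \<in> carrier (sec P V) \<and> (\<forall>y\<in>V. \<sigma> y = germ T P y V s)},
       monoid.mult = undefined, one = undefined,
       zero = to_sheafification T P U \<zero>\<^bsub>sec P U\<^esub>,
       add = (\<lambda>\<sigma> \<tau>. \<lambda>x\<in>U. \<Union>{germ T P x W (s \<oplus>\<^bsub>sec P W\<^esub> t) |W s t. (W, s) \<in> \<sigma> x \<and> (W, t) \<in> \<tau> x}),
       module.smult = (\<lambda>a \<sigma>. \<lambda>x\<in>U. \<Union>{germ T P x W (res A U W a \<odot>\<^bsub>sec P W\<^esub> s) |W s.
           (W, s) \<in> \<sigma> x \<and> W \<subseteq> U})\<rparr>),
     res = (\<lambda>U V \<sigma>. restrict \<sigma> V)\<rparr>"

definition quotient_presheaf ::
  "('x, 'r, 'm) module_presheaf \<Rightarrow> ('x set \<Rightarrow> 'm set) \<Rightarrow> ('x, 'r, 'm set) module_presheaf" where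
  "quotient_presheaf M N =
    \<lparr>sec = (\<lambda>U. \<lparr>carrier = a_rcosets\<^bsub>sec M U\<^esub> (N U),
       monoid.mult = undefined, one = undefined,
       zero = N U,
       add = (\<lambda>C D. C <+>\<^bsub>sec M U\<^esub> D),
       module.smult = (\<lambda>a C. \<Union>c\<in>C. N U +>\<^bsub>sec M U\<^esub> (a \<odot>\<^bsub>sec M U\<^esub> c))\<rparr>),
     res = (\<lambda>U V C. \<Union>c\<in>C. N V +>\<^bsub>sec M V\<^esub> res M U V c)\<rparr>"

definition quotient_sheaf ::
  "'x topology \<Rightarrow> ('x, 'r) algebra_presheaf \<Rightarrow> ('x, 'r, 'm) module_presheaf \<Rightarrow>
   ('x set \<Rightarrow> 'm set) \<Rightarrow> ('x, 'r, 'x \<Rightarrow> ('x set \<times> 'm set) set) module_presheaf" where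
  "quotient_sheaf T A M N = sheafification T A (quotient_presheaf M N)"

definition quotient_class ::
  "'x topology \<Rightarrow> ('x, 'r, 'm) module_presheaf \<Rightarrow> ('x set \<Rightarrow> 'm set) \<Rightarrow> 'x set \<Rightarrow> 'm \<Rightarrow>
   'x \<Rightarrow> ('x set \<times> 'm set) set" where
  "quotient_class T M N U s = to_sheafification T (quotient_presheaf M N) U (N U +>\<^bsub>sec M U\<^esub> s)"

locale pairing = F: module_sheaf T A F + E: module_sheaf T A E
  for T :: "'x topology" and A :: "('x, 'r) algebra_presheaf"
    and F :: "('x, 'r, 'f) module_presheaf" and E :: "('x, 'r, 'e) module_presheaf" +
  fixes \<Phi> :: "'x set \<Rightarrow> 'f \<Rightarrow> 'e \<Rightarrow> 'r"
  assumes closed: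
      "\<lbrakk>openin T U; t \<in> carrier (sec F U); s \<in> carrier (sec E U)\<rbrakk> \<Longrightarrow> \<Phi> U t s \<in> carrier (sec A U)"
    and add_left:
      "\<lbrakk>openin T U; t \<in> carrier (sec F U); t' \<in> carrier (sec F U); s \<in> carrier (sec E U)\<rbrakk>
        \<Longrightarrow> \<Phi> U (t \<oplus>\<^bsub>sec F U\<^esub> t') s = \<Phi> U t s \<oplus>\<^bsub>sec A U\<^esub> \<Phi> U t' s"
    and add_right:
      "\<lbrakk>openin T U; t \<in> carrier (sec F U); s \<in> carrier (sec E U); s' \<in> carrier (sec E U)\<rbrakk>
        \<Longrightarrow> \<Phi> U t (s \<oplus>\<^bsub>sec E U\<^esub> s') = \<Phi> U t s \<oplus>\<^bsub>sec A U\<^esub> \<Phi> U t s'"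
    and smult_left:
      "\<lbrakk>openin T U; a \<in> carrier (sec A U); t \<in> carrier (sec F U); s \<in> carrier (sec E U)\<rbrakk>
        \<Longrightarrow> \<Phi> U (a \<odot>\<^bsub>sec F U\<^esub> t) s = a \<otimes>\<^bsub>sec A U\<^esub> \<Phi> U t s"
    and smult_right:
      "\<lbrakk>openin T U; a \<in> carrier (sec A U); t \<in> carrier (sec F U); s \<in> carrier (sec E U)\<rbrakk>
        \<Longrightarrow> \<Phi> U t (a \<odot>\<^bsub>sec E U\<^esub> s) = a \<otimes>\<^bsub>sec A U\<^esub> \<Phi> U t s"
    and natural:
      "\<lbrakk>openin T U; openin T V; V \<subseteq> U; t \<in> carrier (sec F U); s \<in> carrier (sec E U)\<rbrakk>
        \<Longrightarrow> res A U V (\<Phi> U t s) = \<Phi> V (res F U V t) (res E U V s)"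

text \<open>
  The submodule of the sheaf \<open>M\<close> generated by a subpresheaf \<open>N\<close> of submodules: the image in \<open>M\<close> of
  the sheafification of \<open>N\<close>, i.e. the sections that lie locally in \<open>N\<close>.
\<close>

definition generated_submodule ::
  "'x topology \<Rightarrow> ('x, 'r, 'm) module_presheaf \<Rightarrow> ('x set \<Rightarrow> 'm set) \<Rightarrow> 'x set \<Rightarrow> 'm set" where
  "generated_submodule T M N U =
    {s \<in> carrier (sec M U). \<forall>x\<in>U. \<exists>V. openin T V \<and> x \<in> V \<and> V \<subseteq> U \<and> res M U V s \<in> N V}"

definition left_orthogonal ::
  "('x, 'r) algebra_presheaf \<Rightarrow> ('x, 'r, 'f) module_presheaf \<Rightarrow> ('x, 'r, 'e) module_presheaf \<Rightarrow>
   ('x set \<Rightarrow> 'f \<Rightarrow> 'e \<Rightarrow> 'r) \<Rightarrow> 'x set \<Rightarrow> 'f set" where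
  "left_orthogonal A F E \<Phi> U =
    {t \<in> carrier (sec F U). \<forall>s\<in>carrier (sec E U). \<Phi> U t s = \<zero>\<^bsub>sec A U\<^esub>}"

definition right_orthogonal ::
  "('x, 'r) algebra_presheaf \<Rightarrow> ('x, 'r, 'f) module_presheaf \<Rightarrow> ('x, 'r, 'e) module_presheaf \<Rightarrow>
   ('x set \<Rightarrow> 'f \<Rightarrow> 'e \<Rightarrow> 'r) \<Rightarrow> 'x set \<Rightarrow> 'e set" where
  "right_orthogonal A F E \<Phi> U =
    {s \<in> carrier (sec E U). \<forall>t\<in>carrier (sec F U). \<Phi> U t s = \<zero>\<^bsub>sec A U\<^esub>}"

text \<open>\<open>left_kernel\<close> is \<open>E\<^sup>\<bottom> \<subseteq> F\<close> and \<open>right_kernel\<close> is \<open>F\<^sup>\<bottom> \<subseteq> E\<close>.\<close>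

definition left_kernel ::
  "'x topology \<Rightarrow> ('x, 'r) algebra_presheaf \<Rightarrow> ('x, 'r, 'f) module_presheaf \<Rightarrow>
   ('x, 'r, 'e) module_presheaf \<Rightarrow> ('x set \<Rightarrow> 'f \<Rightarrow> 'e \<Rightarrow> 'r) \<Rightarrow> 'x set \<Rightarrow> 'f set" where
  "left_kernel T A F E \<Phi> = generated_submodule T F (left_orthogonal A F E \<Phi>)"

definition right_kernel ::
  "'x topology \<Rightarrow> ('x, 'r) algebra_presheaf \<Rightarrow> ('x, 'r, 'f) module_presheaf \<Rightarrow>
   ('x, 'r, 'e) module_presheaf \<Rightarrow> ('x set \<Rightarrow> 'f \<Rightarrow> 'e \<Rightarrow> 'r) \<Rightarrow> 'x set \<Rightarrow> 'e set" where
  "right_kernel T A F E \<Phi> = generated_submodule T E (right_orthogonal A F E \<Phi>)"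

definition nondegenerate ::
  "'x topology \<Rightarrow> ('x, 'r) algebra_presheaf \<Rightarrow> ('x, 'r, 'f) module_presheaf \<Rightarrow>
   ('x, 'r, 'e) module_presheaf \<Rightarrow> ('x set \<Rightarrow> 'f \<Rightarrow> 'e \<Rightarrow> 'r) \<Rightarrow> bool" where
  "nondegenerate T A F E \<Phi> \<longleftrightarrow>
    (\<forall>U. openin T U \<longrightarrow>
      left_kernel T A F E \<Phi> U = {\<zero>\<^bsub>sec F U\<^esub>} \<and> right_kernel T A F E \<Phi> U = {\<zero>\<^bsub>sec E U\<^esub>})"

text \<open>
  The map on sheafifications induced by compatible maps \<open>\<phi> U : P(U) \<times> Q(U) \<rightarrow> A(U)\<close> into a sheaf
  \<open>A\<close>: the value at \<open>(\<sigma>, \<tau>)\<close> is obtained by gluing the \<open>\<phi> V p q\<close>, where \<open>p\<close> and \<open>q\<close> represent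
  \<open>\<sigma>\<close> and \<open>\<tau>\<close> over \<open>V\<close>.
\<close>

definition sheafified_pairing ::
  "'x topology \<Rightarrow> ('x, 'r) algebra_presheaf \<Rightarrow> ('x, 'r, 'p) module_presheaf \<Rightarrow>
   ('x, 'r, 'q) module_presheaf \<Rightarrow> ('x set \<Rightarrow> 'p \<Rightarrow> 'q \<Rightarrow> 'r) \<Rightarrow>
   'x set \<Rightarrow> ('x \<Rightarrow> ('x set \<times> 'p) set) \<Rightarrow> ('x \<Rightarrow> ('x set \<times> 'q) set) \<Rightarrow> 'r" where
  "sheafified_pairing T A P Q \<phi> U \<sigma> \<tau> =
    (THE a. a \<in> carrier (sec A U) \<and>
      (\<forall>x\<in>U. \<exists>V p q. openin T V \<and> x \<in> V \<and> V \<subseteq> U \<and>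
        p \<in> carrier (sec P V) \<and> q \<in> carrier (sec Q V) \<and>
        restrict \<sigma> V = to_sheafification T P V p \<and> restrict \<tau> V = to_sheafification T Q V q \<and>
        res A U V a = \<phi> V p q))"

definition induced_pairing ::
  "'x topology \<Rightarrow> ('x, 'r) algebra_presheaf \<Rightarrow> ('x, 'r, 'f) module_presheaf \<Rightarrow>
   ('x, 'r, 'e) module_presheaf \<Rightarrow> ('x set \<Rightarrow> 'f \<Rightarrow> 'e \<Rightarrow> 'r) \<Rightarrow>
   'x set \<Rightarrow> ('x \<Rightarrow> ('x set \<times> 'f set) set) \<Rightarrow> ('x \<Rightarrow> ('x set \<times> 'e set) set) \<Rightarrow> 'r" where
  "induced_pairing T A F E \<Phi> =
    sheafified_pairing T A
      (quotient_presheaf F (left_kernel T A F E \<Phi>))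
      (quotient_presheaf E (right_kernel T A F E \<Phi>))
      (\<lambda>U C D. THE a. \<exists>t\<in>C. \<exists>s\<in>D. a = \<Phi> U t s)"

end

theory Submission
  imports Defs
begin

text \<open>
  Everything rests on one consequence of freeness. Let \<open>e\<^sub>0, \<dots>, e\<^sub>n\<^sub>-\<^sub>1\<close> be the global sections of the
  free sheaf \<open>E\<close> that correspond to the unit vectors. Over every open set \<open>U\<close> their restrictions
  generate \<open>E(U)\<close>, so a section \<open>t\<close> of \<open>F\<close> over \<open>U\<close> is orthogonal to \<open>E(U)\<close> as soon as
  \<open>\<Phi>\<^sub>U(t, e\<^sub>j|\<^sub>U) = 0\<close> for all \<open>j\<close>. Orthogonality is thus a condition on finitely many sections that
  are defined globally.

  For the isomorphism, consider sections over the whole space \<open>X\<close>. The map \<open>t \<mapsto> (\<Phi>(t, e\<^sub>j))\<^sub>j\<close> is \<open>A(X)\<close>-linear from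
  \<open>F(X) \<cong> A(X)\<^sup>m\<close> to \<open>A(X)\<^sup>n\<close>, and it is injective when the left kernel vanishes. Over a nonzero
  commutative ring, a homogeneous linear system with more unknowns than equations has a nonzero
  solution (\<open>underdetermined_system\<close>, a theorem of McCoy), hence \<open>m \<le> n\<close> (\<open>rank_le\<close>). The pairing with
  its arguments exchanged gives \<open>n \<le> m\<close>, so that both modules are isomorphic to the same \<open>A\<^sup>n\<close>. When
  \<open>A(X)\<close> is the zero ring, every ring \<open>A(U)\<close> receives a homomorphism from it and is zero too, and
  then so are both modules.

  As to the induced pairing, since \<open>A\<close> is a sheaf, the left kernel over \<open>U\<close> is exactly the orthogonal of \<open>E(U)\<close>
  (\<open>left_kernel_eq_orthogonal\<close>); by the test on the sections \<open>e\<^sub>j\<close> it is stable under restriction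
  (\<open>left_orthogonal_res\<close>). So the quotients \<open>F(U)/E\<^sup>\<bottom>(U)\<close> form a presheaf of modules, \<open>\<Phi>\<close> descends to
  these quotients, and a pairing of presheaves with values in the sheaf \<open>A\<close> extends to the generated
  sheaves by gluing local values (\<open>pairing_sheafification\<close>). For nondegeneracy, let \<open>\<sigma>\<close> be a section of
  \<open>F/E\<^sup>\<bottom>\<close> over \<open>U\<close> that is orthogonal to all sections of \<open>E/F\<^sup>\<bottom>\<close> over \<open>U\<close>. On a small \<open>V \<subseteq> U\<close> it is the
  class of some \<open>t \<in> F(V)\<close>. The classes of the \<open>e\<^sub>j|\<^sub>U\<close> are sections over all of \<open>U\<close>, so
  \<open>\<Phi>\<^sub>V(t, e\<^sub>j|\<^sub>V) = 0\<close> for all \<open>j\<close>, which puts \<open>t\<close> into \<open>E\<^sup>\<bottom>(V)\<close>: the class of \<open>t\<close> is zero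
  (\<open>left_kernel_induced\<close>). The other kernel follows by exchanging the arguments of \<open>\<Phi>\<close>.
\<close>

section \<open>Underdetermined linear systems over a commutative ring\<close>

text \<open>
  Finitely many elements that become nilpotent in the localisation \<open>R[1/c]\<close> have a common
  annihilator that is nonzero there. Elements of \<open>R\<close> stand for their images in \<open>R[1/c]\<close>: an element
  \<open>a\<close> is nilpotent there iff \<open>c \<otimes> a\<close> is nilpotent, and \<open>r\<close> is nonzero there iff no power of \<open>c\<close> kills
  \<open>r\<close>. One treats the elements one after another, multiplying \<open>r\<close> by the highest power of the new
  element \<open>a\<close> that does not make it vanish in \<open>R[1/c]\<close>.
\<close>

lemma (in cring) annihilator_of_nilpotents:
  assumes "finite S" "S \<subseteq> carrier R" "c \<in> carrier R" "\<And>k. c [^] (k::nat) \<noteq> \<zero>"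
    and "\<And>a. a \<in> S \<Longrightarrow> \<exists>k. (c \<otimes> a) [^] (k::nat) = \<zero>"
  shows "\<exists>r\<in>carrier R. (\<forall>a\<in>S. r \<otimes> a = \<zero>) \<and> (\<forall>k. c [^] (k::nat) \<otimes> r \<noteq> \<zero>)"
  using assms(1,2,5)
proof (induction S rule: finite_induct)
  case empty
  then show ?case using assms(3,4) by (intro bexI[of _ \<one>]) auto
next
  case (insert a S)
  have a: "a \<in> carrier R" using insert by auto
  obtain r where r: "r \<in> carrier R" "\<forall>b\<in>S. r \<otimes> b = \<zero>" "\<forall>k. c [^] (k::nat) \<otimes> r \<noteq> \<zero>"
    using insert by auto
  obtain N where N: "(c \<otimes> a) [^] (N::nat) = \<zero>" using insert.prems by auto
  \<comment> \<open>\<open>P l\<close> says that \<open>r \<otimes> a [^] l\<close> vanishes in the localisation.\<close>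
  define P where "P l \<longleftrightarrow> (\<exists>k::nat. c [^] k \<otimes> (r \<otimes> a [^] l) = \<zero>)" for l :: nat
  have "c [^] N \<otimes> (r \<otimes> a [^] N) = r \<otimes> (c \<otimes> a) [^] N"
    using a r(1) assms(3) by (simp add: nat_pow_distrib m_lcomm)
  then have "P N" unfolding P_def using N r(1) by (metis r_null)
  define l where "l = (LEAST l. P l)"
  have Pl: "P l" unfolding l_def using \<open>P N\<close> by (rule LeastI)
  have "\<not> P 0" unfolding P_def using r by simp
  then obtain l' where l': "l = Suc l'" using Pl by (cases l) auto
  have "\<not> P l'" using not_less_Least[of l' P] l' l_def by auto
  obtain k :: nat where k: "c [^] k \<otimes> (r \<otimes> a [^] l) = \<zero>" using Pl unfolding P_def by auto
  let ?r = "c [^] k \<otimes> (r \<otimes> a [^] l')"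
  show ?case
  proof (intro bexI[of _ ?r] conjI allI ballI)
    show "?r \<in> carrier R" using a r assms(3) by simp
  next
    fix b assume "b \<in> insert a S"
    show "?r \<otimes> b = \<zero>"
    proof (cases "b = a")
      case True
      then show ?thesis using k l' a r(1) assms(3) by (simp add: m_assoc)
    next
      case False
      then have b: "b \<in> S" "b \<in> carrier R" using \<open>b \<in> insert a S\<close> insert.prems by auto
      have "?r \<otimes> b = (c [^] k \<otimes> a [^] l') \<otimes> (r \<otimes> b)"
        using a r(1) b(2) assms(3) by (simp add: m_ac)
      then show ?thesis using r b(1) a assms(3) by simp
    qed
  next
    fix j :: nat
    have "c [^] j \<otimes> ?r = c [^] (j + k) \<otimes> (r \<otimes> a [^] l')"
      using a r(1) assms(3) by (simp add: nat_pow_mult[symmetric] m_assoc)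
    then show "c [^] j \<otimes> ?r \<noteq> \<zero>" using \<open>\<not> P l'\<close> unfolding P_def by auto
  qed
qed

text \<open>
  Gaussian elimination, with a localisation in place of a division. If all coefficients are nilpotent
  in \<open>R[1/c]\<close>, a constant vector whose entry annihilates them all is a solution. Otherwise some
  coefficient \<open>a\<close> is not nilpotent there; it is a unit in the nonzero ring \<open>R[1/(ca)]\<close> and serves as a
  pivot, which removes one equation and one unknown. The assertion about the powers of \<open>c\<close> says that
  the solution is nonzero in \<open>R[1/c]\<close>; it keeps the induction inside \<open>R\<close>, so that no localisation has
  to be constructed.
\<close>

lemma (in cring) underdetermined_system_localised:
  assumes "finite I" "finite J" "card I < card J"
    and "\<And>i j. i \<in> I \<Longrightarrow> j \<in> J \<Longrightarrow> M i j \<in> carrier R"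
    and "c \<in> carrier R" "\<And>k. c [^] (k::nat) \<noteq> \<zero>"
  shows "\<exists>v\<in>J \<rightarrow> carrier R. (\<forall>i\<in>I. (\<Oplus>j\<in>J. M i j \<otimes> v j) = \<zero>)
    \<and> (\<forall>k. \<exists>j\<in>J. c [^] (k::nat) \<otimes> v j \<noteq> \<zero>)"
  using assms
proof (induction "card I" arbitrary: I J M c rule: less_induct)
  case (less I J M c)
  show ?case
  proof (cases "\<forall>i\<in>I. \<forall>j\<in>J. \<exists>k. (c \<otimes> M i j) [^] (k::nat) = \<zero>")
    case True
    let ?S = "(\<lambda>(i, j). M i j) ` (I \<times> J)"
    have "\<exists>r\<in>carrier R. (\<forall>a\<in>?S. r \<otimes> a = \<zero>) \<and> (\<forall>k. c [^] (k::nat) \<otimes> r \<noteq> \<zero>)"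
      using less.prems True by (intro annihilator_of_nilpotents) auto
    then obtain r where r: "r \<in> carrier R" "\<And>i j. i \<in> I \<Longrightarrow> j \<in> J \<Longrightarrow> r \<otimes> M i j = \<zero>"
      "\<And>k. c [^] (k::nat) \<otimes> r \<noteq> \<zero>" by fastforce
    have "J \<noteq> {}" using less.prems(3) by auto
    show ?thesis
    proof (intro bexI[of _ "\<lambda>j. r"] conjI ballI allI)
      fix i assume "i \<in> I"
      have "(\<Oplus>j\<in>J. M i j \<otimes> r) = (\<Oplus>j\<in>J. \<zero>)"
        using r \<open>i \<in> I\<close> less.prems(4) by (intro finsum_cong') (auto simp: m_comm)
      then show "(\<Oplus>j\<in>J. M i j \<otimes> r) = \<zero>" by simp
    qed (use r \<open>J \<noteq> {}\<close> in auto)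
  next
    case False
    then obtain i0 j0 where ij: "i0 \<in> I" "j0 \<in> J" "\<And>k. (c \<otimes> M i0 j0) [^] (k::nat) \<noteq> \<zero>" by blast
    define a where "a = M i0 j0"
    let ?I = "I - {i0}" and ?J = "J - {j0}"
    \<comment> \<open>Eliminating the unknown \<open>j0\<close>: row \<open>i\<close> times the pivot, minus a multiple of the pivot row.\<close>
    define M' where "M' i j = a \<otimes> M i j \<ominus> M i j0 \<otimes> M i0 j" for i j
    have a: "a \<in> carrier R" using ij less.prems a_def by auto
    have "\<exists>v\<in>?J \<rightarrow> carrier R. (\<forall>i\<in>?I. (\<Oplus>j\<in>?J. M' i j \<otimes> v j) = \<zero>)
        \<and> (\<forall>k. \<exists>j\<in>?J. (c \<otimes> a) [^] (k::nat) \<otimes> v j \<noteq> \<zero>)"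
    proof (rule less.hyps)
      show "card ?I < card I" using ij less.prems by (meson card_Diff1_less)
      show "card ?I < card ?J" using ij less.prems by (simp add: card_Diff_singleton)
         (metis card_gt_0_iff diff_less_mono empty_iff Suc_leI)
    qed (use less.prems ij a in \<open>auto simp: M'_def a_def\<close>)
    then obtain w where w: "w \<in> ?J \<rightarrow> carrier R" "\<And>i. i \<in> ?I \<Longrightarrow> (\<Oplus>j\<in>?J. M' i j \<otimes> w j) = \<zero>"
      "\<And>k. \<exists>j\<in>?J. (c \<otimes> a) [^] (k::nat) \<otimes> w j \<noteq> \<zero>" by blast
    have w_closed: "w j \<in> carrier R" if "j \<in> ?J" for j
      using w(1) that by (rule funcset_mem)
    define row where "row i = (\<Oplus>j\<in>?J. M i j \<otimes> w j)" for i
    have M: "M i j \<in> carrier R" if "i \<in> I" "j \<in> J" for i j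
      using that less.prems(4) by blast
    have Mw: "M i j \<otimes> w j \<in> carrier R" if "i \<in> I" "j \<in> ?J" for i j
      using that w_closed M by simp
    have row: "row i \<in> carrier R" if "i \<in> I" for i
      unfolding row_def using Mw[OF that] by (intro finsum_closed) auto
    \<comment> \<open>The value at \<open>j0\<close> solves the pivot equation; scaling by \<open>a\<close> avoids dividing by the pivot.\<close>
    define v where "v j = (if j = j0 then \<ominus> row i0 else a \<otimes> w j)" for j
    have v: "v \<in> J \<rightarrow> carrier R"
    proof
      fix j assume "j \<in> J"
      then show "v j \<in> carrier R" using w_closed[of j] a row[OF ij(1)] by (simp add: v_def)
    qed
    have sum_v: "(\<Oplus>j\<in>J. M i j \<otimes> v j) = a \<otimes> row i \<ominus> M i j0 \<otimes> row i0" if i: "i \<in> I" for i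
    proof -
      have J: "J = insert j0 ?J" using ij by auto
      have "(\<Oplus>j\<in>J. M i j \<otimes> v j) = M i j0 \<otimes> v j0 \<oplus> (\<Oplus>j\<in>?J. M i j \<otimes> v j)"
        by (subst J, rule finsum_insert) (use less.prems(2) M[OF i] funcset_mem[OF v] ij in auto)
      also have "(\<Oplus>j\<in>?J. M i j \<otimes> v j) = (\<Oplus>j\<in>?J. a \<otimes> (M i j \<otimes> w j))"
      proof (rule finsum_cong')
        fix j assume j: "j \<in> ?J"
        then show "M i j \<otimes> v j = a \<otimes> (M i j \<otimes> w j)"
          using w_closed[OF j] a M[OF i, of j] by (simp add: v_def m_lcomm)
      qed (use Mw[OF i] a in auto)
      also have "\<dots> = a \<otimes> row i"
        unfolding row_def using less.prems(2) a Mw[OF i] by (intro finsum_rdistr[symmetric]) auto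
      finally show ?thesis
        using row[OF i] row[OF ij(1)] a M[OF i ij(2)]
        by (simp add: v_def minus_eq r_minus a_comm)
    qed
    have reduced: "a \<otimes> row i \<ominus> M i j0 \<otimes> row i0 = (\<Oplus>j\<in>?J. M' i j \<otimes> w j)" if i: "i \<in> I" for i
    proof -
      have Mij: "M i j0 \<in> carrier R" using i ij(2) by (rule M)
      have "(\<Oplus>j\<in>?J. M' i j \<otimes> w j) = (\<Oplus>j\<in>?J. a \<otimes> (M i j \<otimes> w j) \<oplus> (\<ominus> M i j0) \<otimes> (M i0 j \<otimes> w j))"
      proof (rule finsum_cong')
        fix j assume j: "j \<in> ?J"
        then show "M' i j \<otimes> w j = a \<otimes> (M i j \<otimes> w j) \<oplus> (\<ominus> M i j0) \<otimes> (M i0 j \<otimes> w j)"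
          using w_closed[OF j] a M[OF i, of j] M[OF ij(1), of j] Mij
          by (simp add: M'_def minus_eq l_distr l_minus m_assoc)
      qed (use Mw[OF i] Mw[OF ij(1)] a Mij in auto)
      also have "\<dots> = (\<Oplus>j\<in>?J. a \<otimes> (M i j \<otimes> w j)) \<oplus> (\<Oplus>j\<in>?J. (\<ominus> M i j0) \<otimes> (M i0 j \<otimes> w j))"
        using Mw[OF i] Mw[OF ij(1)] a Mij by (intro finsum_addf) auto
      also have "\<dots> = a \<otimes> row i \<oplus> (\<ominus> M i j0) \<otimes> row i0"
        unfolding row_def using less.prems(2) a Mij Mw[OF i] Mw[OF ij(1)]
        by (intro arg_cong2[where f = "(\<oplus>)"] finsum_rdistr[symmetric]) auto
      finally show ?thesis using row[OF i] row[OF ij(1)] a Mij by (simp add: minus_eq l_minus)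
    qed
    show ?thesis
    proof (intro bexI[of _ v] conjI ballI allI)
      fix i assume i: "i \<in> I"
      show "(\<Oplus>j\<in>J. M i j \<otimes> v j) = \<zero>"
      proof (cases "i = i0")
        case True
        then show ?thesis using sum_v[OF i] row[OF i] a unfolding a_def by (simp add: r_neg minus_eq)
      next
        case False
        then show ?thesis using sum_v[OF i] reduced[OF i] w(2) i by simp
      qed
    next
      fix k
      obtain j where j: "j \<in> ?J" "(c \<otimes> a) [^] (Suc k) \<otimes> w j \<noteq> \<zero>" using w(3) by blast
      have wj: "w j \<in> carrier R" using w(1) j by auto
      have "(c \<otimes> a) [^] (Suc k) \<otimes> w j = (c \<otimes> a [^] k) \<otimes> (c [^] k \<otimes> v j)"
        using j(1) wj a less.prems(5) by (simp add: v_def nat_pow_distrib m_ac)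
      then have "c [^] k \<otimes> v j \<noteq> \<zero>" using j a less.prems(5) by (metis m_closed nat_pow_closed r_null)
      then show "\<exists>j\<in>J. c [^] k \<otimes> v j \<noteq> \<zero>" using j by blast
    qed (rule v)
  qed
qed

lemma (in cring) underdetermined_system:
  assumes "finite I" "finite J" "card I < card J" "\<one> \<noteq> \<zero>"
    and "\<And>i j. i \<in> I \<Longrightarrow> j \<in> J \<Longrightarrow> M i j \<in> carrier R"
  shows "\<exists>v\<in>J \<rightarrow> carrier R. (\<forall>i\<in>I. (\<Oplus>j\<in>J. M i j \<otimes> v j) = \<zero>) \<and> (\<exists>j\<in>J. v j \<noteq> \<zero>)"
proof -
  obtain v where v: "v \<in> J \<rightarrow> carrier R" "\<forall>i\<in>I. (\<Oplus>j\<in>J. M i j \<otimes> v j) = \<zero>"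
    "\<forall>k. \<exists>j\<in>J. \<one> [^] (k::nat) \<otimes> v j \<noteq> \<zero>"
    using underdetermined_system_localised[of I J M \<one>] assms by auto
  obtain j where j: "j \<in> J" "\<one> [^] (0::nat) \<otimes> v j \<noteq> \<zero>"
    using v(3) by blast
  then have "v j \<noteq> \<zero>" by auto
  then show ?thesis using v(1,2) j(1) by blast
qed

section \<open>Presheaves of modules and their germs\<close>

lemma (in algebraized_space) sec_cring: "openin T U \<Longrightarrow> cring (sec A U)"
  using sec_algebra algebra.M_cring by blast

lemma (in algebraized_space) section_eq_locally:
  assumes U: "openin T U" and ab: "a \<in> carrier (sec A U)" "b \<in> carrier (sec A U)"
    and loc: "\<And>x. x \<in> U \<Longrightarrow> \<exists>W. openin T W \<and> x \<in> W \<and> W \<subseteq> U \<and> res A U W a = res A U W b"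
  shows "a = b"
proof -
  let ?C = "{W. openin T W \<and> W \<subseteq> U \<and> res A U W a = res A U W b}"
  have "\<Union>?C = U" using loc by blast
  then show ?thesis using locality[of ?C a b] ab by auto
qed

lemma (in algebraized_space) res_ring_hom_cring:
  "\<lbrakk>openin T U; openin T V; V \<subseteq> U\<rbrakk> \<Longrightarrow> ring_hom_cring (sec A U) (sec A V) (res A U V)"
  by (intro ring_hom_cringI sec_cring res_ring_hom)

text \<open>
  The quotients \<open>F(U)/N(U)\<close> satisfy everything that is asked of a sheaf of modules except for
  locality and gluing. This is the structure that sheafification starts from.
\<close>

locale presheaf_of_modules = base: algebraized_space T A + set_presheaf T P
  for T :: "'x topology" and A :: "('x, 'r) algebra_presheaf"
    and P :: "('x, 'r, 'm) module_presheaf" +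
  assumes sec_module: "openin T U \<Longrightarrow> module (sec A U) (sec P U)"
    and res_add:
      "\<lbrakk>openin T U; openin T V; V \<subseteq> U; s \<in> carrier (sec P U); t \<in> carrier (sec P U)\<rbrakk>
        \<Longrightarrow> res P U V (s \<oplus>\<^bsub>sec P U\<^esub> t) = res P U V s \<oplus>\<^bsub>sec P V\<^esub> res P U V t"
    and res_smult:
      "\<lbrakk>openin T U; openin T V; V \<subseteq> U; a \<in> carrier (sec A U); s \<in> carrier (sec P U)\<rbrakk>
        \<Longrightarrow> res P U V (a \<odot>\<^bsub>sec P U\<^esub> s) = res A U V a \<odot>\<^bsub>sec P V\<^esub> res P U V s"

sublocale module_sheaf \<subseteq> presheaf: presheaf_of_modules T A M
  by (intro presheaf_of_modules.intro presheaf_of_modules_axioms.intro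
      base.algebraized_space_axioms set_presheaf_axioms)
    (rule sec_module res_add res_smult; assumption)+

context set_presheaf
begin

lemma germ_eqI:
  assumes "openin T W" "x \<in> W" "W \<subseteq> U" "W \<subseteq> V" "openin T U" "openin T V"
    and "s \<in> carrier (sec P U)" "t \<in> carrier (sec P V)" "res P U W s = res P V W t"
  shows "germ T P x U s = germ T P x V t"
proof -
  have sub: "germ T P x U s \<subseteq> germ T P x V t"
    if *: "openin T W" "x \<in> W" "W \<subseteq> U" "W \<subseteq> V" "openin T U" "openin T V"
      "s \<in> carrier (sec P U)" "t \<in> carrier (sec P V)" "res P U W s = res P V W t" for U V s t
  proof (clarsimp simp: germ_def)
    fix V' t' W'
    assume h: "openin T V'" "t' \<in> carrier (sec P V')" "openin T W'" "x \<in> W'" "W' \<subseteq> U" "W' \<subseteq> V'"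
      "res P U W' s = res P V' W' t'"
    let ?W = "W \<inter> W'"
    have W: "openin T ?W" using * h by blast
    have "res P V ?W t = res P W ?W (res P V W t)" using * W by (simp add: res_comp)
    also have "\<dots> = res P U ?W s" using * W by (simp flip: *(9) add: res_comp)
    also have "\<dots> = res P W' ?W (res P U W' s)" using *(1-8) W h(1-6) by (simp add: res_comp)
    also have "\<dots> = res P V' ?W t'" unfolding h(7) using h(1-6) W by (simp add: res_comp)
    finally show "\<exists>W. openin T W \<and> x \<in> W \<and> W \<subseteq> V \<and> W \<subseteq> V' \<and> res P V W t = res P V' W t'"
      using W * h by (intro exI[of _ ?W]) auto
  qed
  show ?thesis using sub[of U V s t] sub[of V U t s] assms by auto
qed

lemma germ_self: "\<lbrakk>openin T U; x \<in> U; s \<in> carrier (sec P U)\<rbrakk> \<Longrightarrow> (U, s) \<in> germ T P x U s"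
  unfolding germ_def by blast

lemma germ_eqD:
  assumes "openin T V" "x \<in> V" "t \<in> carrier (sec P V)" "germ T P x U s = germ T P x V t"
  shows "\<exists>W. openin T W \<and> x \<in> W \<and> W \<subseteq> U \<and> W \<subseteq> V \<and> res P U W s = res P V W t"
  using germ_self[OF assms(1-3)] unfolding assms(4)[symmetric] unfolding germ_def by auto

lemma germ_res:
  assumes "openin T U" "openin T V" "V \<subseteq> U" "x \<in> V" "s \<in> carrier (sec P U)"
  shows "germ T P x V (res P U V s) = germ T P x U s"
  using assms by (intro germ_eqI[of V]) (auto simp: res_closed res_id)

text \<open>
  \<open>represented \<sigma> V s\<close> says that over the open set \<open>V\<close> the family of germs \<open>\<sigma>\<close> is given by the single
  section \<open>s\<close>. The domain of \<open>\<sigma>\<close> may be larger than \<open>V\<close>, so no restriction map is needed to speak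
  about local representatives.
\<close>

definition represented :: "('x \<Rightarrow> ('x set \<times> 'a) set) \<Rightarrow> 'x set \<Rightarrow> 'a \<Rightarrow> bool" where
  "represented \<sigma> V s \<longleftrightarrow> openin T V \<and> s \<in> carrier (sec P V) \<and> (\<forall>y\<in>V. \<sigma> y = germ T P y V s)"

lemma represented_res:
  "\<lbrakk>represented \<sigma> V s; openin T W; W \<subseteq> V\<rbrakk> \<Longrightarrow> represented \<sigma> W (res P V W s)"
  unfolding represented_def by (auto simp: res_closed germ_res)

lemma represented_restrict:
  assumes "V \<subseteq> U"
  shows "represented (restrict \<sigma> U) V s \<longleftrightarrow> represented \<sigma> V s"
proof -
  have "restrict \<sigma> U y = \<sigma> y" if "y \<in> V" for y
    using that assms by auto
  then show ?thesis unfolding represented_def by metis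
qed

lemma represented_to_sheafification:
  "\<lbrakk>openin T V; s \<in> carrier (sec P V)\<rbrakk> \<Longrightarrow> represented (to_sheafification T P V s) V s"
  unfolding represented_def to_sheafification_def by auto

lemma represented_iff_restrict:
  "represented \<sigma> V s \<longleftrightarrow>
    openin T V \<and> s \<in> carrier (sec P V) \<and> restrict \<sigma> V = to_sheafification T P V s"
  unfolding represented_def to_sheafification_def
  by (auto simp: fun_eq_iff restrict_def)

text \<open>
  Representatives are unique only after shrinking the open set, since the presheaf need not be
  separated.
\<close>

lemma represented_unique_locally:
  assumes "represented \<sigma> V s" "represented \<sigma> V' s'" "x \<in> V" "x \<in> V'"
  shows "\<exists>W. openin T W \<and> x \<in> W \<and> W \<subseteq> V \<and> W \<subseteq> V' \<and> res P V W s = res P V' W s'"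
  using assms germ_eqD[of V' x s' V s] unfolding represented_def by auto

end

section \<open>The sheaf of modules generated by a presheaf\<close>

context presheaf_of_modules
begin

abbreviation S where "S \<equiv> sheafification T A P"

lemma carrier_sheafification:
  "carrier (sec S U) = {\<sigma> \<in> extensional U. \<forall>x\<in>U. \<exists>V s. x \<in> V \<and> V \<subseteq> U \<and> represented \<sigma> V s}"
  unfolding sheafification_def represented_def by (simp add: conj_ac)

lemma res_sheafification: "res S U V \<sigma> = restrict \<sigma> V"
  by (simp add: sheafification_def)

lemma zero_sheafification: "\<zero>\<^bsub>sec S U\<^esub> = to_sheafification T P U \<zero>\<^bsub>sec P U\<^esub>"
  by (simp add: sheafification_def)

text \<open>
  The principle behind all identities between sections of the generated sheaf: it suffices to find
  common local representatives, and these can be computed in the modules of the presheaf.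
\<close>

lemma section_eqI:
  assumes "\<sigma> \<in> extensional U" "\<tau> \<in> extensional U"
    and "\<And>x. x \<in> U \<Longrightarrow> \<exists>V s. x \<in> V \<and> represented \<sigma> V s \<and> represented \<tau> V s"
  shows "\<sigma> = \<tau>"
  using assms(1,2)
proof (rule extensionalityI)
  show "\<sigma> x = \<tau> x" if "x \<in> U" for x
    using assms(3)[OF that] by (auto simp: represented_def)
qed

lemma res_zero:
  assumes "openin T U" "openin T V" "V \<subseteq> U"
  shows "res P U V \<zero>\<^bsub>sec P U\<^esub> = \<zero>\<^bsub>sec P V\<^esub>"
proof -
  interpret U: module "sec A U" "sec P U" using assms sec_module by blast
  interpret V: module "sec A V" "sec P V" using assms sec_module by blast
  have "res P U V \<zero>\<^bsub>sec P U\<^esub> = res P U V \<zero>\<^bsub>sec P U\<^esub> \<oplus>\<^bsub>sec P V\<^esub> res P U V \<zero>\<^bsub>sec P U\<^esub>"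
    using res_add[OF assms U.zero_closed U.zero_closed] by simp
  then show ?thesis using res_closed[OF assms U.zero_closed]
    by (metis V.add.r_cancel_one')
qed

lemma represented_zero:
  assumes "openin T U" "openin T V" "V \<subseteq> U"
  shows "represented \<zero>\<^bsub>sec S U\<^esub> V \<zero>\<^bsub>sec P V\<^esub>"
proof -
  interpret module "sec A U" "sec P U" using assms sec_module by blast
  show ?thesis
    using represented_res[OF represented_to_sheafification[OF assms(1) zero_closed] assms(2,3)] assms
    by (simp add: zero_sheafification res_zero)
qed

text \<open>
  Addition on the stalks is a union over all pairs of representatives on a common open set. The
  germ of the sum does not depend on the choice, so the union is one of equal sets.
\<close>

lemma represented_add:
  assumes "represented \<sigma> V s" "represented \<tau> V t" "V \<subseteq> U"
  shows "represented (\<sigma> \<oplus>\<^bsub>sec S U\<^esub> \<tau>) V (s \<oplus>\<^bsub>sec P V\<^esub> t)"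
proof -
  have V: "openin T V" and s: "s \<in> carrier (sec P V)" and t: "t \<in> carrier (sec P V)"
    using assms by (auto simp: represented_def)
  interpret V: module "sec A V" "sec P V" using V sec_module by blast
  show ?thesis unfolding represented_def
  proof (intro conjI ballI)
    fix x assume x: "x \<in> V"
    have \<sigma>: "\<sigma> x = germ T P x V s" and \<tau>: "\<tau> x = germ T P x V t"
      using assms x by (auto simp: represented_def)
    have eq: "germ T P x W (s' \<oplus>\<^bsub>sec P W\<^esub> t') = germ T P x V (s \<oplus>\<^bsub>sec P V\<^esub> t)"
      if m: "(W, s') \<in> \<sigma> x" "(W, t') \<in> \<tau> x" for W s' t'
    proof -
      have W: "openin T W" "x \<in> W" "s' \<in> carrier (sec P W)" "t' \<in> carrier (sec P W)"
        using m unfolding \<sigma> \<tau> germ_def by auto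
      obtain W1 where W1: "openin T W1" "x \<in> W1" "W1 \<subseteq> V" "W1 \<subseteq> W" "res P V W1 s = res P W W1 s'"
        using m(1) unfolding \<sigma> germ_def by auto
      obtain W2 where W2: "openin T W2" "x \<in> W2" "W2 \<subseteq> V" "W2 \<subseteq> W" "res P V W2 t = res P W W2 t'"
        using m(2) unfolding \<tau> germ_def by auto
      let ?W = "W1 \<inter> W2"
      have o: "openin T ?W" "?W \<subseteq> V" "?W \<subseteq> W" "x \<in> ?W" using W1 W2 by auto
      interpret W: module "sec A W" "sec P W" using W sec_module by blast
      have "res P V ?W s = res P W ?W s'"
        using W1 o V s W res_comp[of V W1 ?W s] res_comp[of W W1 ?W s'] by auto
      moreover have "res P V ?W t = res P W ?W t'"
        using W2 o V t W res_comp[of V W2 ?W t] res_comp[of W W2 ?W t'] by auto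
      ultimately show ?thesis
        using o V s t W by (intro germ_eqI[of ?W]) (auto simp: res_add)
    qed
    have "(\<sigma> \<oplus>\<^bsub>sec S U\<^esub> \<tau>) x =
        \<Union>{germ T P x W (s' \<oplus>\<^bsub>sec P W\<^esub> t') |W s' t'. (W, s') \<in> \<sigma> x \<and> (W, t') \<in> \<tau> x}"
      using x assms(3) by (auto simp: sheafification_def)
    also have "{germ T P x W (s' \<oplus>\<^bsub>sec P W\<^esub> t') |W s' t'. (W, s') \<in> \<sigma> x \<and> (W, t') \<in> \<tau> x}
        = {germ T P x V (s \<oplus>\<^bsub>sec P V\<^esub> t)}" (is "?G = _")
    proof
      show "?G \<subseteq> {germ T P x V (s \<oplus>\<^bsub>sec P V\<^esub> t)}" using eq by blast
      have "(V, s) \<in> \<sigma> x" "(V, t) \<in> \<tau> x" using germ_self V x s t unfolding \<sigma> \<tau> by auto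
      then show "{germ T P x V (s \<oplus>\<^bsub>sec P V\<^esub> t)} \<subseteq> ?G" by blast
    qed
    finally show "(\<sigma> \<oplus>\<^bsub>sec S U\<^esub> \<tau>) x = germ T P x V (s \<oplus>\<^bsub>sec P V\<^esub> t)" by simp
  qed (use V s t in auto)
qed

lemma represented_smult:
  assumes "represented \<sigma> V s" "V \<subseteq> U" "openin T U" "a \<in> carrier (sec A U)"
  shows "represented (a \<odot>\<^bsub>sec S U\<^esub> \<sigma>) V (res A U V a \<odot>\<^bsub>sec P V\<^esub> s)"
proof -
  have V: "openin T V" and s: "s \<in> carrier (sec P V)" 
    using assms by (auto simp: represented_def)
  interpret V: module "sec A V" "sec P V" using V sec_module by blast
  have aV: "res A U V a \<in> carrier (sec A V)" using assms V base.res_closed by blast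
  show ?thesis unfolding represented_def
  proof (intro conjI ballI)
    fix x assume x: "x \<in> V"
    have \<sigma>: "\<sigma> x = germ T P x V s" 
      using assms x by (auto simp: represented_def)
    have eq: "germ T P x W (res A U W a \<odot>\<^bsub>sec P W\<^esub> s') = germ T P x V (res A U V a \<odot>\<^bsub>sec P V\<^esub> s)"
      if m: "(W, s') \<in> \<sigma> x" "W \<subseteq> U" for W s'
    proof -
      have W: "openin T W" "x \<in> W" "s' \<in> carrier (sec P W)" 
        using m unfolding \<sigma> germ_def by auto
      obtain W1 where W1: "openin T W1" "x \<in> W1" "W1 \<subseteq> V" "W1 \<subseteq> W" "res P V W1 s = res P W W1 s'"
        using m(1) unfolding \<sigma> germ_def by auto
      interpret W: module "sec A W" "sec P W" using W sec_module by blast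
      have aW: "res A U W a \<in> carrier (sec A W)" using assms W m base.res_closed by blast
      have "res A V W1 (res A U V a) = res A W W1 (res A U W a)"
        using W1 W V assms m by (simp add: base.res_comp)
      then show ?thesis
        using W1 V s W aV aW by (intro germ_eqI[of W1]) (auto simp: res_smult)
    qed
    have "(a \<odot>\<^bsub>sec S U\<^esub> \<sigma>) x =
        \<Union>{germ T P x W (res A U W a \<odot>\<^bsub>sec P W\<^esub> s') |W s'. (W, s') \<in> \<sigma> x \<and> W \<subseteq> U}"
      using x assms(2) by (auto simp: sheafification_def)
    also have "{germ T P x W (res A U W a \<odot>\<^bsub>sec P W\<^esub> s') |W s'. (W, s') \<in> \<sigma> x \<and> W \<subseteq> U}
        = {germ T P x V (res A U V a \<odot>\<^bsub>sec P V\<^esub> s)}" (is "?G = _")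
    proof
      show "?G \<subseteq> {germ T P x V (res A U V a \<odot>\<^bsub>sec P V\<^esub> s)}" using eq by blast
      have "(V, s) \<in> \<sigma> x" using germ_self V x s unfolding \<sigma> by auto
      then show "{germ T P x V (res A U V a \<odot>\<^bsub>sec P V\<^esub> s)} \<subseteq> ?G" using assms(2) by blast
    qed
    finally show "(a \<odot>\<^bsub>sec S U\<^esub> \<sigma>) x = germ T P x V (res A U V a \<odot>\<^bsub>sec P V\<^esub> s)" by simp
  qed (use V s aV in auto)
qed

lemma section_represented:
  assumes "\<sigma> \<in> carrier (sec S U)" "x \<in> U"
  obtains V s where "x \<in> V" "V \<subseteq> U" "represented \<sigma> V s"
  using assms unfolding carrier_sheafification by blast

lemma section_extensional: "\<sigma> \<in> carrier (sec S U) \<Longrightarrow> \<sigma> \<in> extensional U"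
  unfolding carrier_sheafification by blast

text \<open>
  Representatives of several sections can be taken over the same open set, namely the intersection
  of the open sets on which the individual ones exist.
\<close>

lemma sections_represented2:
  assumes "\<sigma> \<in> carrier (sec S U)" "\<tau> \<in> carrier (sec S U)" "x \<in> U"
  obtains V s t where "x \<in> V" "V \<subseteq> U" "represented \<sigma> V s" "represented \<tau> V t"
proof -
  obtain V s where V: "x \<in> V" "V \<subseteq> U" "represented \<sigma> V s"
    using section_represented[OF assms(1,3)] .
  obtain W t where W: "x \<in> W" "W \<subseteq> U" "represented \<tau> W t"
    using section_represented[OF assms(2,3)] .
  have o: "openin T (V \<inter> W)" using V W by (auto simp: represented_def)
  show ?thesis
    using that[of "V \<inter> W"] represented_res[OF V(3) o] represented_res[OF W(3) o] V W by blast
qed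

lemma sections_represented3:
  assumes "\<sigma> \<in> carrier (sec S U)" "\<tau> \<in> carrier (sec S U)" "\<rho> \<in> carrier (sec S U)" "x \<in> U"
  obtains V s t r where "x \<in> V" "V \<subseteq> U" "represented \<sigma> V s" "represented \<tau> V t" "represented \<rho> V r"
proof -
  obtain V s t where V: "x \<in> V" "V \<subseteq> U" "represented \<sigma> V s" "represented \<tau> V t"
    using sections_represented2[OF assms(1,2,4)] .
  obtain W r where W: "x \<in> W" "W \<subseteq> U" "represented \<rho> W r"
    using section_represented[OF assms(3,4)] .
  have o: "openin T (V \<inter> W)" using V W by (auto simp: represented_def)
  show ?thesis
    using that[of "V \<inter> W"] represented_res[OF V(3) o] represented_res[OF V(4) o]
      represented_res[OF W(3) o] V W by blast
qed

lemma to_sheafification_closed: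
  assumes "openin T U" "s \<in> carrier (sec P U)"
  shows "to_sheafification T P U s \<in> carrier (sec S U)"
  using represented_to_sheafification[OF assms]
  unfolding carrier_sheafification by (auto simp: to_sheafification_def)

lemma zero_closed: 
  assumes "openin T U" shows "\<zero>\<^bsub>sec S U\<^esub> \<in> carrier (sec S U)"
proof -
  interpret module "sec A U" "sec P U" using assms sec_module by blast
  show ?thesis using to_sheafification_closed[OF assms zero_closed] by (simp add: zero_sheafification)
qed

lemma add_extensional: "\<sigma> \<oplus>\<^bsub>sec S U\<^esub> \<tau> \<in> extensional U"
  and smult_extensional: "a \<odot>\<^bsub>sec S U\<^esub> \<sigma> \<in> extensional U"
  by (simp_all add: sheafification_def)

lemma add_closed:
  assumes "\<sigma> \<in> carrier (sec S U)" "\<tau> \<in> carrier (sec S U)"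
  shows "\<sigma> \<oplus>\<^bsub>sec S U\<^esub> \<tau> \<in> carrier (sec S U)"
  unfolding carrier_sheafification
proof (intro CollectI conjI ballI add_extensional)
  fix x assume "x \<in> U"
  then obtain V s t where V: "x \<in> V" "V \<subseteq> U" "represented \<sigma> V s" "represented \<tau> V t"
    using sections_represented2 assms by metis
  show "\<exists>V s. x \<in> V \<and> V \<subseteq> U \<and> represented (\<sigma> \<oplus>\<^bsub>sec S U\<^esub> \<tau>) V s"
    using represented_add[OF V(3,4,2)] V(1,2) by blast
qed

lemma smult_closed:
  assumes "openin T U" "a \<in> carrier (sec A U)" "\<sigma> \<in> carrier (sec S U)"
  shows "a \<odot>\<^bsub>sec S U\<^esub> \<sigma> \<in> carrier (sec S U)"
  unfolding carrier_sheafification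
proof (intro CollectI conjI ballI smult_extensional)
  fix x assume "x \<in> U"
  then obtain V s where V: "x \<in> V" "V \<subseteq> U" "represented \<sigma> V s"
    using section_represented assms by metis
  show "\<exists>V s. x \<in> V \<and> V \<subseteq> U \<and> represented (a \<odot>\<^bsub>sec S U\<^esub> \<sigma>) V s"
    using represented_smult[OF V(3,2) assms(1,2)] V(1,2) by blast
qed

lemma sheafification_abelian_group:
  assumes U: "openin T U"
  shows "abelian_group (sec S U)"
proof (rule abelian_groupI)
  fix \<sigma> \<tau> \<rho>
  assume st: "\<sigma> \<in> carrier (sec S U)" "\<tau> \<in> carrier (sec S U)" "\<rho> \<in> carrier (sec S U)"
  show "(\<sigma> \<oplus>\<^bsub>sec S U\<^esub> \<tau>) \<oplus>\<^bsub>sec S U\<^esub> \<rho> = \<sigma> \<oplus>\<^bsub>sec S U\<^esub> (\<tau> \<oplus>\<^bsub>sec S U\<^esub> \<rho>)"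
  proof (rule section_eqI)
    fix x assume "x \<in> U"
    then obtain V s t r where V: "x \<in> V" "V \<subseteq> U" 
      and r: "represented \<sigma> V s" "represented \<tau> V t" "represented \<rho> V r"
      using sections_represented3 st by metis
    interpret module "sec A V" "sec P V" using r sec_module by (auto simp: represented_def)
    have "(s \<oplus>\<^bsub>sec P V\<^esub> t) \<oplus>\<^bsub>sec P V\<^esub> r = s \<oplus>\<^bsub>sec P V\<^esub> (t \<oplus>\<^bsub>sec P V\<^esub> r)"
      using r by (auto simp: represented_def M.a_assoc)
    moreover have "represented ((\<sigma> \<oplus>\<^bsub>sec S U\<^esub> \<tau>) \<oplus>\<^bsub>sec S U\<^esub> \<rho>) V ((s \<oplus>\<^bsub>sec P V\<^esub> t) \<oplus>\<^bsub>sec P V\<^esub> r)"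
      by (intro represented_add r V)
    moreover have "represented (\<sigma> \<oplus>\<^bsub>sec S U\<^esub> (\<tau> \<oplus>\<^bsub>sec S U\<^esub> \<rho>)) V (s \<oplus>\<^bsub>sec P V\<^esub> (t \<oplus>\<^bsub>sec P V\<^esub> r))"
      by (intro represented_add r V)
    ultimately show "\<exists>V s. x \<in> V \<and> represented ((\<sigma> \<oplus>\<^bsub>sec S U\<^esub> \<tau>) \<oplus>\<^bsub>sec S U\<^esub> \<rho>) V s \<and>
        represented (\<sigma> \<oplus>\<^bsub>sec S U\<^esub> (\<tau> \<oplus>\<^bsub>sec S U\<^esub> \<rho>)) V s" using V by metis
  qed (rule add_extensional)+
next
  fix \<sigma> \<tau>
  assume st: "\<sigma> \<in> carrier (sec S U)" "\<tau> \<in> carrier (sec S U)"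
  show "\<sigma> \<oplus>\<^bsub>sec S U\<^esub> \<tau> = \<tau> \<oplus>\<^bsub>sec S U\<^esub> \<sigma>"
  proof (rule section_eqI)
    fix x assume "x \<in> U"
    then obtain V s t where V: "x \<in> V" "V \<subseteq> U" and r: "represented \<sigma> V s" "represented \<tau> V t"
      using sections_represented2 st by metis
    interpret module "sec A V" "sec P V" using r sec_module by (auto simp: represented_def)
    have "s \<oplus>\<^bsub>sec P V\<^esub> t = t \<oplus>\<^bsub>sec P V\<^esub> s"
      using r by (auto simp: represented_def M.a_comm)
    then show "\<exists>V s. x \<in> V \<and> represented (\<sigma> \<oplus>\<^bsub>sec S U\<^esub> \<tau>) V s \<and> represented (\<tau> \<oplus>\<^bsub>sec S U\<^esub> \<sigma>) V s"
      using V represented_add[OF r V(2)] represented_add[OF r(2,1) V(2)] by metis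
  qed (rule add_extensional)+
next
  fix \<sigma> assume \<sigma>: "\<sigma> \<in> carrier (sec S U)"
  show "\<zero>\<^bsub>sec S U\<^esub> \<oplus>\<^bsub>sec S U\<^esub> \<sigma> = \<sigma>"
  proof (rule section_eqI)
    fix x assume "x \<in> U"
    then obtain V s where V: "x \<in> V" "V \<subseteq> U" and r: "represented \<sigma> V s"
      using section_represented \<sigma> by metis
    have o: "openin T V" using r by (auto simp: represented_def)
    interpret module "sec A V" "sec P V" using o by (rule sec_module)
    have "\<zero>\<^bsub>sec P V\<^esub> \<oplus>\<^bsub>sec P V\<^esub> s = s"
      using r by (auto simp: represented_def)
    then show "\<exists>V s. x \<in> V \<and> represented (\<zero>\<^bsub>sec S U\<^esub> \<oplus>\<^bsub>sec S U\<^esub> \<sigma>) V s \<and> represented \<sigma> V s"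
      using V represented_add[OF represented_zero[OF U o V(2)] r V(2)] r by metis
  qed (rule add_extensional section_extensional[OF \<sigma>])+
next
  fix \<sigma> assume \<sigma>: "\<sigma> \<in> carrier (sec S U)"
  interpret UA: cring "sec A U" using U by (rule base.sec_cring)
  \<comment> \<open>Taking the inverse to be \<open>-1\<close> times the section reuses the closure under scalars.\<close>
  let ?m = "\<ominus>\<^bsub>sec A U\<^esub> \<one>\<^bsub>sec A U\<^esub>"
  show "\<exists>\<tau>\<in>carrier (sec S U). \<tau> \<oplus>\<^bsub>sec S U\<^esub> \<sigma> = \<zero>\<^bsub>sec S U\<^esub>"
  proof (rule bexI[of _ "?m \<odot>\<^bsub>sec S U\<^esub> \<sigma>"])
    show "?m \<odot>\<^bsub>sec S U\<^esub> \<sigma> \<oplus>\<^bsub>sec S U\<^esub> \<sigma> = \<zero>\<^bsub>sec S U\<^esub>"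
    proof (rule section_eqI)
      fix x assume "x \<in> U"
      then obtain V s where V: "x \<in> V" "V \<subseteq> U" and r: "represented \<sigma> V s"
        using section_represented \<sigma> by metis
      have o: "openin T V" and s: "s \<in> carrier (sec P V)" using r by (auto simp: represented_def)
      interpret module "sec A V" "sec P V" using o by (rule sec_module)
      interpret h: ring_hom_cring "sec A U" "sec A V" "res A U V"
        using base.res_ring_hom[OF U o V(2)] by (intro ring_hom_cringI) unfold_locales
      have "res A U V ?m \<odot>\<^bsub>sec P V\<^esub> s \<oplus>\<^bsub>sec P V\<^esub> s = \<zero>\<^bsub>sec P V\<^esub>"
        using s by (simp add: smult_l_minus M.l_neg)
      moreover have "represented (?m \<odot>\<^bsub>sec S U\<^esub> \<sigma> \<oplus>\<^bsub>sec S U\<^esub> \<sigma>) V (res A U V ?m \<odot>\<^bsub>sec P V\<^esub> s \<oplus>\<^bsub>sec P V\<^esub> s)"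
        by (intro represented_add represented_smult r V U) simp
      ultimately show "\<exists>V s. x \<in> V \<and> represented (?m \<odot>\<^bsub>sec S U\<^esub> \<sigma> \<oplus>\<^bsub>sec S U\<^esub> \<sigma>) V s \<and> represented \<zero>\<^bsub>sec S U\<^esub> V s"
        using V represented_zero[OF U o V(2)] by metis
    qed (rule add_extensional section_extensional[OF zero_closed[OF U]])+
    show "?m \<odot>\<^bsub>sec S U\<^esub> \<sigma> \<in> carrier (sec S U)" using U \<sigma> by (intro smult_closed) auto
  qed
qed (auto intro: add_closed zero_closed U)

lemma sheafification_module:
  assumes U: "openin T U"
  shows "module (sec A U) (sec S U)"
proof (rule moduleI)
  interpret UA: cring "sec A U" using U by (rule base.sec_cring)
  show "cring (sec A U)" "abelian_group (sec S U)"
    using U by (auto intro: base.sec_cring sheafification_abelian_group)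
  note ext = add_extensional smult_extensional section_extensional
  fix a \<sigma> assume a: "a \<in> carrier (sec A U)" and \<sigma>: "\<sigma> \<in> carrier (sec S U)"
  show "a \<odot>\<^bsub>sec S U\<^esub> \<sigma> \<in> carrier (sec S U)" using U a \<sigma> by (rule smult_closed)
  {
    fix b assume b: "b \<in> carrier (sec A U)"
    show "(a \<oplus>\<^bsub>sec A U\<^esub> b) \<odot>\<^bsub>sec S U\<^esub> \<sigma> = a \<odot>\<^bsub>sec S U\<^esub> \<sigma> \<oplus>\<^bsub>sec S U\<^esub> b \<odot>\<^bsub>sec S U\<^esub> \<sigma>"
    proof (rule section_eqI[OF smult_extensional add_extensional])
      fix x assume "x \<in> U"
      then obtain V s where V: "x \<in> V" "V \<subseteq> U" and r: "represented \<sigma> V s"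
        using section_represented \<sigma> by metis
      have o: "openin T V" and s: "s \<in> carrier (sec P V)" using r by (auto simp: represented_def)
      interpret module "sec A V" "sec P V" using o by (rule sec_module)
      interpret h: ring_hom_cring "sec A U" "sec A V" "res A U V"
        using base.res_ring_hom[OF U o V(2)] by (intro ring_hom_cringI) unfold_locales
      have "res A U V (a \<oplus>\<^bsub>sec A U\<^esub> b) \<odot>\<^bsub>sec P V\<^esub> s =
          res A U V a \<odot>\<^bsub>sec P V\<^esub> s \<oplus>\<^bsub>sec P V\<^esub> res A U V b \<odot>\<^bsub>sec P V\<^esub> s"
        using a b s by (simp add: smult_l_distr)
      moreover have "represented ((a \<oplus>\<^bsub>sec A U\<^esub> b) \<odot>\<^bsub>sec S U\<^esub> \<sigma>) V (res A U V (a \<oplus>\<^bsub>sec A U\<^esub> b) \<odot>\<^bsub>sec P V\<^esub> s)"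
        using a b by (intro represented_smult r V U) simp
      moreover have "represented (a \<odot>\<^bsub>sec S U\<^esub> \<sigma> \<oplus>\<^bsub>sec S U\<^esub> b \<odot>\<^bsub>sec S U\<^esub> \<sigma>) V
          (res A U V a \<odot>\<^bsub>sec P V\<^esub> s \<oplus>\<^bsub>sec P V\<^esub> res A U V b \<odot>\<^bsub>sec P V\<^esub> s)"
        by (intro represented_smult represented_add r V U a b)
      ultimately show "\<exists>V s. x \<in> V \<and> represented ((a \<oplus>\<^bsub>sec A U\<^esub> b) \<odot>\<^bsub>sec S U\<^esub> \<sigma>) V s \<and>
          represented (a \<odot>\<^bsub>sec S U\<^esub> \<sigma> \<oplus>\<^bsub>sec S U\<^esub> b \<odot>\<^bsub>sec S U\<^esub> \<sigma>) V s"
        using V by metis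
    qed
    show "(a \<otimes>\<^bsub>sec A U\<^esub> b) \<odot>\<^bsub>sec S U\<^esub> \<sigma> = a \<odot>\<^bsub>sec S U\<^esub> (b \<odot>\<^bsub>sec S U\<^esub> \<sigma>)"
    proof (rule section_eqI[OF smult_extensional smult_extensional])
      fix x assume "x \<in> U"
      then obtain V s where V: "x \<in> V" "V \<subseteq> U" and r: "represented \<sigma> V s"
        using section_represented \<sigma> by metis
      have o: "openin T V" and s: "s \<in> carrier (sec P V)" using r by (auto simp: represented_def)
      interpret module "sec A V" "sec P V" using o by (rule sec_module)
      interpret h: ring_hom_cring "sec A U" "sec A V" "res A U V"
        using base.res_ring_hom[OF U o V(2)] by (intro ring_hom_cringI) unfold_locales
      have "res A U V (a \<otimes>\<^bsub>sec A U\<^esub> b) \<odot>\<^bsub>sec P V\<^esub> s =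
          res A U V a \<odot>\<^bsub>sec P V\<^esub> (res A U V b \<odot>\<^bsub>sec P V\<^esub> s)"
        using a b s by (simp add: smult_assoc1)
      moreover have "represented ((a \<otimes>\<^bsub>sec A U\<^esub> b) \<odot>\<^bsub>sec S U\<^esub> \<sigma>) V (res A U V (a \<otimes>\<^bsub>sec A U\<^esub> b) \<odot>\<^bsub>sec P V\<^esub> s)"
        using a b by (intro represented_smult r V U) simp
      moreover have "represented (a \<odot>\<^bsub>sec S U\<^esub> (b \<odot>\<^bsub>sec S U\<^esub> \<sigma>)) V
          (res A U V a \<odot>\<^bsub>sec P V\<^esub> (res A U V b \<odot>\<^bsub>sec P V\<^esub> s))"
        by (intro represented_smult r V U a b)
      ultimately show "\<exists>V s. x \<in> V \<and> represented ((a \<otimes>\<^bsub>sec A U\<^esub> b) \<odot>\<^bsub>sec S U\<^esub> \<sigma>) V s \<and>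
          represented (a \<odot>\<^bsub>sec S U\<^esub> (b \<odot>\<^bsub>sec S U\<^esub> \<sigma>)) V s"
        using V by metis
    qed
  }
  {
    fix \<tau> assume \<tau>: "\<tau> \<in> carrier (sec S U)"
    show "a \<odot>\<^bsub>sec S U\<^esub> (\<sigma> \<oplus>\<^bsub>sec S U\<^esub> \<tau>) = a \<odot>\<^bsub>sec S U\<^esub> \<sigma> \<oplus>\<^bsub>sec S U\<^esub> a \<odot>\<^bsub>sec S U\<^esub> \<tau>"
    proof (rule section_eqI[OF smult_extensional add_extensional])
      fix x assume "x \<in> U"
      then obtain V s t where V: "x \<in> V" "V \<subseteq> U" and r: "represented \<sigma> V s" "represented \<tau> V t"
        using sections_represented2 \<sigma> \<tau> by metis
      have o: "openin T V" and s: "s \<in> carrier (sec P V)" "t \<in> carrier (sec P V)"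
        using r by (auto simp: represented_def)
      interpret module "sec A V" "sec P V" using o by (rule sec_module)
      have "res A U V a \<odot>\<^bsub>sec P V\<^esub> (s \<oplus>\<^bsub>sec P V\<^esub> t) =
          res A U V a \<odot>\<^bsub>sec P V\<^esub> s \<oplus>\<^bsub>sec P V\<^esub> res A U V a \<odot>\<^bsub>sec P V\<^esub> t"
        using a s base.res_closed[OF U o V(2)] by (simp add: smult_r_distr)
      moreover have "represented (a \<odot>\<^bsub>sec S U\<^esub> (\<sigma> \<oplus>\<^bsub>sec S U\<^esub> \<tau>)) V
          (res A U V a \<odot>\<^bsub>sec P V\<^esub> (s \<oplus>\<^bsub>sec P V\<^esub> t))"
        by (intro represented_smult represented_add r V U a)
      moreover have "represented (a \<odot>\<^bsub>sec S U\<^esub> \<sigma> \<oplus>\<^bsub>sec S U\<^esub> a \<odot>\<^bsub>sec S U\<^esub> \<tau>) V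
          (res A U V a \<odot>\<^bsub>sec P V\<^esub> s \<oplus>\<^bsub>sec P V\<^esub> res A U V a \<odot>\<^bsub>sec P V\<^esub> t)"
        by (intro represented_smult represented_add r V U a)
      ultimately show "\<exists>V s. x \<in> V \<and> represented (a \<odot>\<^bsub>sec S U\<^esub> (\<sigma> \<oplus>\<^bsub>sec S U\<^esub> \<tau>)) V s \<and>
          represented (a \<odot>\<^bsub>sec S U\<^esub> \<sigma> \<oplus>\<^bsub>sec S U\<^esub> a \<odot>\<^bsub>sec S U\<^esub> \<tau>) V s"
        using V by metis
    qed
  }
next
  interpret UA: cring "sec A U" using U by (rule base.sec_cring)
  fix \<sigma> assume \<sigma>: "\<sigma> \<in> carrier (sec S U)"
  show "\<one>\<^bsub>sec A U\<^esub> \<odot>\<^bsub>sec S U\<^esub> \<sigma> = \<sigma>"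
  proof (rule section_eqI[OF smult_extensional section_extensional[OF \<sigma>]])
    fix x assume "x \<in> U"
    then obtain V s where V: "x \<in> V" "V \<subseteq> U" and r: "represented \<sigma> V s"
      using section_represented \<sigma> by metis
    have o: "openin T V" and s: "s \<in> carrier (sec P V)" using r by (auto simp: represented_def)
    interpret module "sec A V" "sec P V" using o by (rule sec_module)
    interpret h: ring_hom_cring "sec A U" "sec A V" "res A U V"
      using base.res_ring_hom[OF U o V(2)] by (intro ring_hom_cringI) unfold_locales
    have "represented (\<one>\<^bsub>sec A U\<^esub> \<odot>\<^bsub>sec S U\<^esub> \<sigma>) V (res A U V \<one>\<^bsub>sec A U\<^esub> \<odot>\<^bsub>sec P V\<^esub> s)"
      by (intro represented_smult r V U UA.one_closed)
    then show "\<exists>V s. x \<in> V \<and> represented (\<one>\<^bsub>sec A U\<^esub> \<odot>\<^bsub>sec S U\<^esub> \<sigma>) V s \<and> represented \<sigma> V s"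
      using V s r by auto
  qed
qed

lemma restrict_section_closed:
  assumes "openin T V" "V \<subseteq> U" "\<sigma> \<in> carrier (sec S U)"
  shows "restrict \<sigma> V \<in> carrier (sec S V)"
  unfolding carrier_sheafification
proof (intro CollectI conjI ballI)
  fix x assume x: "x \<in> V"
  obtain W s where W: "x \<in> W" "represented \<sigma> W s"
    using section_represented[OF assms(3) subsetD[OF assms(2) x]] .
  have o: "openin T (W \<inter> V)" using W assms by (auto simp: represented_def)
  show "\<exists>W s. x \<in> W \<and> W \<subseteq> V \<and> represented (restrict \<sigma> V) W s"
    using represented_res[OF W(2) o] W x represented_restrict[of "W \<inter> V" V \<sigma>] by blast
qed auto

lemma sheafification_gluing:
  assumes C: "\<And>V. V \<in> \<C> \<Longrightarrow> openin T V" and f: "\<And>V. V \<in> \<C> \<Longrightarrow> f V \<in> carrier (sec S V)"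
    and compat: "\<And>V W. \<lbrakk>V \<in> \<C>; W \<in> \<C>\<rbrakk> \<Longrightarrow> res S V (V \<inter> W) (f V) = res S W (V \<inter> W) (f W)"
  shows "\<exists>\<sigma>\<in>carrier (sec S (\<Union>\<C>)). \<forall>V\<in>\<C>. res S (\<Union>\<C>) V \<sigma> = f V"
proof -
  \<comment> \<open>A section is a function on points, so gluing means choosing at each point any member of the cover.\<close>
  define \<sigma> where "\<sigma> = (\<lambda>x\<in>\<Union>\<C>. f (SOME V. V \<in> \<C> \<and> x \<in> V) x)"
  have \<sigma>: "\<sigma> x = f V x" if V: "V \<in> \<C>" "x \<in> V" for x V
  proof -
    let ?W = "SOME V. V \<in> \<C> \<and> x \<in> V"
    have W: "?W \<in> \<C> \<and> x \<in> ?W" using V by (intro someI) auto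
    have "restrict (f V) (V \<inter> ?W) x = restrict (f ?W) (V \<inter> ?W) x"
      using compat[of V ?W] V W by (simp add: res_sheafification)
    then show ?thesis using V W by (auto simp: \<sigma>_def)
  qed
  show ?thesis
  proof (intro bexI[of _ \<sigma>] ballI)
    fix V assume V: "V \<in> \<C>"
    show "res S (\<Union>\<C>) V \<sigma> = f V"
      unfolding res_sheafification
      by (rule extensionalityI[of _ V]) (use V \<sigma> section_extensional[OF f[OF V]] in auto)
  next
    show "\<sigma> \<in> carrier (sec S (\<Union>\<C>))" unfolding carrier_sheafification
    proof (intro CollectI conjI ballI)
      fix x assume "x \<in> \<Union>\<C>"
      then obtain V where V: "V \<in> \<C>" "x \<in> V" by auto
      obtain W s where W: "x \<in> W" "W \<subseteq> V" "represented (f V) W s"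
        using section_represented[OF f[OF V(1)] V(2)] .
      have "represented \<sigma> W s" using W \<sigma>[OF V(1)] by (auto simp: represented_def)
      then show "\<exists>W s. x \<in> W \<and> W \<subseteq> \<Union>\<C> \<and> represented \<sigma> W s" using W V by blast
    qed (simp add: \<sigma>_def)
  qed
qed

proposition sheafification_module_sheaf: "module_sheaf T A S"
proof (intro module_sheaf.intro set_sheaf.intro base.algebraized_space_axioms)
  show "set_presheaf T S"
  proof
    fix U s assume "openin T U" "s \<in> carrier (sec S U)"
    then show "res S U U s = s" by (simp add: res_sheafification section_extensional extensional_restrict)
  qed (auto simp: res_sheafification restrict_section_closed inf.absorb2)
  show "set_sheaf_axioms T S"
  proof
    fix \<C> s t
    assume st: "s \<in> carrier (sec S (\<Union>\<C>))" "t \<in> carrier (sec S (\<Union>\<C>))"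
      and eq: "\<And>V. V \<in> \<C> \<Longrightarrow> res S (\<Union>\<C>) V s = res S (\<Union>\<C>) V t"
    show "s = t"
    proof (rule extensionalityI[OF section_extensional section_extensional, OF st])
      fix x assume "x \<in> \<Union>\<C>"
      then obtain V where "V \<in> \<C>" "x \<in> V" by blast
      then show "s x = t x" using fun_cong[OF eq, of V x] by (simp add: res_sheafification)
    qed
  qed (fact sheafification_gluing)
  show "module_sheaf_axioms T A S"
  proof (rule module_sheaf_axioms.intro)
    fix U V s t assume UV: "openin T U" "openin T V" "V \<subseteq> U"
      and s: "s \<in> carrier (sec S U)" and t: "t \<in> carrier (sec S U)"
    show "res S U V (s \<oplus>\<^bsub>sec S U\<^esub> t) = res S U V s \<oplus>\<^bsub>sec S V\<^esub> res S U V t"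
      unfolding res_sheafification
    proof (rule section_eqI[OF _ add_extensional])
      fix x assume x: "x \<in> V"
      obtain W p q where W: "x \<in> W" "W \<subseteq> V" "represented (restrict s V) W p" "represented (restrict t V) W q"
        using sections_represented2[OF restrict_section_closed restrict_section_closed] UV s t x by metis
      then have W': "represented s W p" "represented t W q" "W \<subseteq> U"
        using UV by (auto simp: represented_restrict)
      have "represented (restrict (s \<oplus>\<^bsub>sec S U\<^esub> t) V) W (p \<oplus>\<^bsub>sec P W\<^esub> q)"
        unfolding represented_restrict[OF W(2)] by (intro represented_add W')
      moreover have "represented (restrict s V \<oplus>\<^bsub>sec S V\<^esub> restrict t V) W (p \<oplus>\<^bsub>sec P W\<^esub> q)"
        by (intro represented_add W(2-4))
      ultimately show "\<exists>W p. x \<in> W \<and> represented (restrict (s \<oplus>\<^bsub>sec S U\<^esub> t) V) W p \<and>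
          represented (restrict s V \<oplus>\<^bsub>sec S V\<^esub> restrict t V) W p"
        using W by blast
    qed simp
  next
    fix U V a s assume UV: "openin T U" "openin T V" "V \<subseteq> U"
      and a: "a \<in> carrier (sec A U)" and s: "s \<in> carrier (sec S U)"
    show "res S U V (a \<odot>\<^bsub>sec S U\<^esub> s) = res A U V a \<odot>\<^bsub>sec S V\<^esub> res S U V s"
      unfolding res_sheafification
    proof (rule section_eqI[OF _ smult_extensional])
      fix x assume x: "x \<in> V"
      obtain W p where W: "x \<in> W" "W \<subseteq> V" "represented (restrict s V) W p"
        using section_represented[OF restrict_section_closed] UV s x by metis
      then have W': "represented s W p" "W \<subseteq> U" "openin T W"
        using UV represented_restrict[of W V s p] by (auto simp: represented_def)
      have "represented (restrict (a \<odot>\<^bsub>sec S U\<^esub> s) V) W (res A U W a \<odot>\<^bsub>sec P W\<^esub> p)"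
        unfolding represented_restrict[OF W(2)] by (intro represented_smult W' UV a)
      moreover have "represented (res A U V a \<odot>\<^bsub>sec S V\<^esub> restrict s V) W
          (res A V W (res A U V a) \<odot>\<^bsub>sec P W\<^esub> p)"
        using UV a by (intro represented_smult W(2,3) UV base.res_closed)
      ultimately show "\<exists>W p. x \<in> W \<and> represented (restrict (a \<odot>\<^bsub>sec S U\<^esub> s) V) W p \<and>
          represented (res A U V a \<odot>\<^bsub>sec S V\<^esub> restrict s V) W p"
        using W W' UV a base.res_comp by metis
    qed simp
  qed (fact sheafification_module)
qed

end

section \<open>Pairings of generated sheaves\<close>

text \<open>
  The quotients to which \<open>\<Phi>\<close> descends are only presheaves, so the axioms of a pairing are needed for
  presheaves of modules before the generated sheaves can be paired.
\<close>

locale presheaf_pairing = P: presheaf_of_modules T A P + Q: presheaf_of_modules T A Q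
  for T :: "'x topology" and A :: "('x, 'r) algebra_presheaf"
    and P :: "('x, 'r, 'p) module_presheaf" and Q :: "('x, 'r, 'q) module_presheaf" +
  fixes \<phi> :: "'x set \<Rightarrow> 'p \<Rightarrow> 'q \<Rightarrow> 'r"
  assumes closed:
      "\<lbrakk>openin T U; t \<in> carrier (sec P U); s \<in> carrier (sec Q U)\<rbrakk> \<Longrightarrow> \<phi> U t s \<in> carrier (sec A U)"
    and add_left:
      "\<lbrakk>openin T U; t \<in> carrier (sec P U); t' \<in> carrier (sec P U); s \<in> carrier (sec Q U)\<rbrakk>
        \<Longrightarrow> \<phi> U (t \<oplus>\<^bsub>sec P U\<^esub> t') s = \<phi> U t s \<oplus>\<^bsub>sec A U\<^esub> \<phi> U t' s"
    and add_right:
      "\<lbrakk>openin T U; t \<in> carrier (sec P U); s \<in> carrier (sec Q U); s' \<in> carrier (sec Q U)\<rbrakk>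
        \<Longrightarrow> \<phi> U t (s \<oplus>\<^bsub>sec Q U\<^esub> s') = \<phi> U t s \<oplus>\<^bsub>sec A U\<^esub> \<phi> U t s'"
    and smult_left:
      "\<lbrakk>openin T U; a \<in> carrier (sec A U); t \<in> carrier (sec P U); s \<in> carrier (sec Q U)\<rbrakk>
        \<Longrightarrow> \<phi> U (a \<odot>\<^bsub>sec P U\<^esub> t) s = a \<otimes>\<^bsub>sec A U\<^esub> \<phi> U t s"
    and smult_right:
      "\<lbrakk>openin T U; a \<in> carrier (sec A U); t \<in> carrier (sec P U); s \<in> carrier (sec Q U)\<rbrakk>
        \<Longrightarrow> \<phi> U t (a \<odot>\<^bsub>sec Q U\<^esub> s) = a \<otimes>\<^bsub>sec A U\<^esub> \<phi> U t s"
    and natural: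
      "\<lbrakk>openin T U; openin T V; V \<subseteq> U; t \<in> carrier (sec P U); s \<in> carrier (sec Q U)\<rbrakk>
        \<Longrightarrow> res A U V (\<phi> U t s) = \<phi> V (res P U V t) (res Q U V s)"
begin

abbreviation \<Psi> where "\<Psi> \<equiv> sheafified_pairing T A P Q \<phi>"

text \<open>
  The property that determines the value of the sheafified pairing at \<open>\<sigma>\<close> and \<open>\<tau>\<close>, phrased with local
  representatives.
\<close>

definition is_value :: "'x set \<Rightarrow> ('x \<Rightarrow> ('x set \<times> 'p) set) \<Rightarrow> ('x \<Rightarrow> ('x set \<times> 'q) set) \<Rightarrow> 'r \<Rightarrow> bool"
  where "is_value U \<sigma> \<tau> a \<longleftrightarrow> a \<in> carrier (sec A U) \<and>
    (\<forall>x\<in>U. \<exists>V p q. x \<in> V \<and> V \<subseteq> U \<and> P.represented \<sigma> V p \<and> Q.represented \<tau> V q \<and>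
      res A U V a = \<phi> V p q)"

lemma sheafified_pairing_eq_The: "\<Psi> U \<sigma> \<tau> = (THE a. is_value U \<sigma> \<tau> a)"
proof -
  have "(openin T V \<and> x \<in> V \<and> V \<subseteq> U \<and> p \<in> carrier (sec P V) \<and> q \<in> carrier (sec Q V) \<and>
      restrict \<sigma> V = to_sheafification T P V p \<and> restrict \<tau> V = to_sheafification T Q V q \<and>
      res A U V a = \<phi> V p q) =
    (x \<in> V \<and> V \<subseteq> U \<and> P.represented \<sigma> V p \<and> Q.represented \<tau> V q \<and> res A U V a = \<phi> V p q)"
    for a x V p q
    unfolding P.represented_iff_restrict Q.represented_iff_restrict by argo
  then show ?thesis unfolding sheafified_pairing_def is_value_def by simp
qed

lemma values_agree_locally:
  assumes "P.represented \<sigma> V p" "Q.represented \<tau> V q"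
    and "P.represented \<sigma> V' p'" "Q.represented \<tau> V' q'" and "x \<in> V" "x \<in> V'"
  shows "\<exists>W. openin T W \<and> x \<in> W \<and> W \<subseteq> V \<and> W \<subseteq> V' \<and>
    res A V W (\<phi> V p q) = res A V' W (\<phi> V' p' q')"
proof -
  obtain W1 where W1: "openin T W1" "x \<in> W1" "W1 \<subseteq> V" "W1 \<subseteq> V'" "res P V W1 p = res P V' W1 p'"
    using P.represented_unique_locally[OF assms(1,3,5,6)] by blast
  obtain W2 where W2: "openin T W2" "x \<in> W2" "W2 \<subseteq> V" "W2 \<subseteq> V'" "res Q V W2 q = res Q V' W2 q'"
    using Q.represented_unique_locally[OF assms(2,4,5,6)] by blast
  let ?W = "W1 \<inter> W2"
  have W: "openin T ?W" "?W \<subseteq> V" "?W \<subseteq> V'" "x \<in> ?W" "?W \<subseteq> W1" "?W \<subseteq> W2" using W1 W2 by auto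
  have V: "openin T V" "p \<in> carrier (sec P V)" "q \<in> carrier (sec Q V)"
    and V': "openin T V'" "p' \<in> carrier (sec P V')" "q' \<in> carrier (sec Q V')"
    using assms by (auto simp: P.represented_def Q.represented_def)
  have p: "res P V ?W p = res P V' ?W p'"
    using P.res_comp[OF V(1) W1(1) W(1,5) W1(3) V(2)]
      P.res_comp[OF V'(1) W1(1) W(1,5) W1(4) V'(2)] W1(5) by simp
  have q: "res Q V ?W q = res Q V' ?W q'"
    using Q.res_comp[OF V(1) W2(1) W(1,6) W2(3) V(3)]
      Q.res_comp[OF V'(1) W2(1) W(1,6) W2(4) V'(3)] W2(5) by simp
  show ?thesis
    using natural[OF V(1) W(1,2) V(2,3)] natural[OF V'(1) W(1,3) V'(2,3)] p q W by metis
qed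

text \<open>
  The definition asks for one suitable neighbourhood of each point; by the local uniqueness of
  representatives and locality in \<open>A\<close>, the value is then correct on every open set where \<open>\<sigma>\<close> and \<open>\<tau>\<close>
  are represented.
\<close>

lemma is_value_represented:
  assumes U: "openin T U" and a: "is_value U \<sigma> \<tau> a" and V: "V \<subseteq> U"
    and r: "P.represented \<sigma> V p" "Q.represented \<tau> V q"
  shows "res A U V a = \<phi> V p q"
proof (rule P.base.section_eq_locally)
  show o: "openin T V" using r by (auto simp: P.represented_def)
  have ac: "a \<in> carrier (sec A U)" using a by (simp add: is_value_def)
  show "res A U V a \<in> carrier (sec A V)" using U V o ac by (intro P.base.res_closed)
  show "\<phi> V p q \<in> carrier (sec A V)"
    using r o by (intro closed) (auto simp: P.represented_def Q.represented_def)
  fix x assume x: "x \<in> V"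
  then obtain V' p' q' where V': "x \<in> V'" "V' \<subseteq> U" "P.represented \<sigma> V' p'" "Q.represented \<tau> V' q'"
    "res A U V' a = \<phi> V' p' q'" using a V unfolding is_value_def by blast
  obtain W where W: "openin T W" "x \<in> W" "W \<subseteq> V" "W \<subseteq> V'"
    "res A V W (\<phi> V p q) = res A V' W (\<phi> V' p' q')"
    using values_agree_locally[OF r V'(3,4) x V'(1)] by blast
  have o': "openin T V'" using V' by (auto simp: P.represented_def)
  have "res A V W (res A U V a) = res A V' W (res A U V' a)"
    using P.base.res_comp[OF U o W(1,3) V ac] P.base.res_comp[OF U o' W(1,4) V'(2) ac] by simp
  then show "\<exists>W. openin T W \<and> x \<in> W \<and> W \<subseteq> V \<and> res A V W (res A U V a) = res A V W (\<phi> V p q)"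
    using W V'(5) by auto
qed

lemma is_value_unique:
  assumes U: "openin T U" and a: "is_value U \<sigma> \<tau> a" and b: "is_value U \<sigma> \<tau> b"
  shows "a = b"
proof (rule P.base.section_eq_locally[OF U])
  show "a \<in> carrier (sec A U)" "b \<in> carrier (sec A U)" using a b by (auto simp: is_value_def)
  fix x assume "x \<in> U"
  then obtain V p q where V: "x \<in> V" "V \<subseteq> U" "P.represented \<sigma> V p" "Q.represented \<tau> V q"
    using a unfolding is_value_def by blast
  have "openin T V" using V by (auto simp: P.represented_def)
  then show "\<exists>W. openin T W \<and> x \<in> W \<and> W \<subseteq> U \<and> res A U W a = res A U W b"
    using V is_value_represented[OF U a V(2-4)] is_value_represented[OF U b V(2-4)] by auto
qed

lemma sheafified_pairing_eqI: "\<lbrakk>openin T U; is_value U \<sigma> \<tau> a\<rbrakk> \<Longrightarrow> \<Psi> U \<sigma> \<tau> = a"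
  unfolding sheafified_pairing_eq_The using is_value_unique by blast

lemma sections_represented_pair:
  assumes "\<sigma> \<in> carrier (sec P.S U)" "\<tau> \<in> carrier (sec Q.S U)" "x \<in> U"
  obtains V p q where "x \<in> V" "V \<subseteq> U" "P.represented \<sigma> V p" "Q.represented \<tau> V q"
proof -
  obtain V p where V: "x \<in> V" "V \<subseteq> U" "P.represented \<sigma> V p"
    using P.section_represented[OF assms(1,3)] .
  obtain W q where W: "x \<in> W" "W \<subseteq> U" "Q.represented \<tau> W q"
    using Q.section_represented[OF assms(2,3)] .
  have o: "openin T (V \<inter> W)" using V W by (auto simp: P.represented_def Q.represented_def)
  show ?thesis
    using that[of "V \<inter> W"] P.represented_res[OF V(3) o] Q.represented_res[OF W(3) o] V W by blast
qed

text \<open>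
  The open sets on which both sections are represented cover \<open>U\<close>, and the values there agree on
  overlaps by uniqueness, so they glue in the sheaf \<open>A\<close>.
\<close>

lemma is_value_exists:
  assumes U: "openin T U" and \<sigma>: "\<sigma> \<in> carrier (sec P.S U)" and \<tau>: "\<tau> \<in> carrier (sec Q.S U)"
  shows "\<exists>a. is_value U \<sigma> \<tau> a"
proof -
  define C where "C = {V. V \<subseteq> U \<and> (\<exists>p q. P.represented \<sigma> V p \<and> Q.represented \<tau> V q)}"
  define f where "f V = (SOME a. \<exists>p q. P.represented \<sigma> V p \<and> Q.represented \<tau> V q \<and> a = \<phi> V p q)" for V
  have f: "\<exists>p q. P.represented \<sigma> V p \<and> Q.represented \<tau> V q \<and> f V = \<phi> V p q" if "V \<in> C" for V
    unfolding f_def by (rule someI_ex) (use that in \<open>auto simp: C_def\<close>)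
  have o: "openin T V" if "V \<in> C" for V
    using that by (auto simp: C_def P.represented_def)
  have fc: "f V \<in> carrier (sec A V)" if V: "V \<in> C" for V
    using f[OF V] closed[OF o[OF V]] by (auto simp: P.represented_def Q.represented_def)
  have UC: "\<Union>C = U"
  proof
    show "U \<subseteq> \<Union>C"
    proof
      fix x assume "x \<in> U"
      then obtain V p q where "x \<in> V" "V \<subseteq> U" "P.represented \<sigma> V p" "Q.represented \<tau> V q"
        by (rule sections_represented_pair[OF \<sigma> \<tau>])
      then show "x \<in> \<Union>C" unfolding C_def by blast
    qed
  qed (auto simp: C_def)
  have "\<exists>a\<in>carrier (sec A (\<Union>C)). \<forall>V\<in>C. res A (\<Union>C) V a = f V"
  proof (rule P.base.gluing[OF o fc])
    fix V W assume V: "V \<in> C" and W: "W \<in> C"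
    let ?D = "V \<inter> W"
    have D: "openin T ?D" using o V W by blast
    show "res A V ?D (f V) = res A W ?D (f W)"
    proof (rule P.base.section_eq_locally[OF D])
      show "res A V ?D (f V) \<in> carrier (sec A ?D)" "res A W ?D (f W) \<in> carrier (sec A ?D)"
        using o fc V W D by (auto intro!: P.base.res_closed)
      fix x assume x: "x \<in> ?D"
      obtain p q where p: "P.represented \<sigma> V p" "Q.represented \<tau> V q" "f V = \<phi> V p q"
        using f[OF V] by blast
      obtain p' q' where p': "P.represented \<sigma> W p'" "Q.represented \<tau> W q'" "f W = \<phi> W p' q'"
        using f[OF W] by blast
      obtain Z where Z: "openin T Z" "x \<in> Z" "Z \<subseteq> V" "Z \<subseteq> W" "res A V Z (f V) = res A W Z (f W)"
        using values_agree_locally[OF p(1,2) p'(1,2), of x] x p(3) p'(3) by auto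
      have ZD: "Z \<subseteq> ?D" using Z by blast
      have "res A ?D Z (res A V ?D (f V)) = res A ?D Z (res A W ?D (f W))"
        using P.base.res_comp[OF o[OF V] D Z(1) ZD _ fc[OF V]]
          P.base.res_comp[OF o[OF W] D Z(1) ZD _ fc[OF W]] Z(5) by simp
      then show "\<exists>Z. openin T Z \<and> x \<in> Z \<and> Z \<subseteq> ?D \<and>
          res A ?D Z (res A V ?D (f V)) = res A ?D Z (res A W ?D (f W))"
        using Z ZD by blast
    qed
  qed
  then obtain a where a: "a \<in> carrier (sec A U)" "\<And>V. V \<in> C \<Longrightarrow> res A U V a = f V"
    unfolding UC by blast
  have "is_value U \<sigma> \<tau> a" unfolding is_value_def
  proof (intro conjI ballI a(1))
    fix x assume "x \<in> U"
    then obtain V where V: "V \<in> C" "x \<in> V" using UC by blast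
    then show "\<exists>V p q. x \<in> V \<and> V \<subseteq> U \<and> P.represented \<sigma> V p \<and> Q.represented \<tau> V q \<and>
        res A U V a = \<phi> V p q"
      using f[OF V(1)] a(2)[OF V(1)] unfolding C_def by force
  qed
  then show ?thesis by blast
qed

lemma is_value_sheafified_pairing:
  "\<lbrakk>openin T U; \<sigma> \<in> carrier (sec P.S U); \<tau> \<in> carrier (sec Q.S U)\<rbrakk> \<Longrightarrow> is_value U \<sigma> \<tau> (\<Psi> U \<sigma> \<tau>)"
  using is_value_exists sheafified_pairing_eqI by metis

lemma sheafified_pairing_closed:
  "\<lbrakk>openin T U; \<sigma> \<in> carrier (sec P.S U); \<tau> \<in> carrier (sec Q.S U)\<rbrakk> \<Longrightarrow> \<Psi> U \<sigma> \<tau> \<in> carrier (sec A U)"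
  using is_value_sheafified_pairing by (simp add: is_value_def)

lemma sheafified_pairing_represented:
  assumes "openin T U" "\<sigma> \<in> carrier (sec P.S U)" "\<tau> \<in> carrier (sec Q.S U)" "V \<subseteq> U"
    and "P.represented \<sigma> V p" "Q.represented \<tau> V q"
  shows "res A U V (\<Psi> U \<sigma> \<tau>) = \<phi> V p q"
  using is_value_represented[OF assms(1) is_value_sheafified_pairing[OF assms(1-3)] assms(4-6)] .

lemma sheafified_pairing_to_sheafification:
  assumes U: "openin T U" and p: "p \<in> carrier (sec P U)" and q: "q \<in> carrier (sec Q U)"
  shows "\<Psi> U (to_sheafification T P U p) (to_sheafification T Q U q) = \<phi> U p q"
proof (rule sheafified_pairing_eqI[OF U])
  show "is_value U (to_sheafification T P U p) (to_sheafification T Q U q) (\<phi> U p q)"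
    unfolding is_value_def
    using P.represented_to_sheafification[OF U p] Q.represented_to_sheafification[OF U q]
      closed[OF assms] P.base.res_id[OF U closed[OF assms]] by blast
qed

text \<open>
  Each identity is verified on open sets where all the sections involved are represented; there it
  is the corresponding identity for \<open>\<phi>\<close>, because restriction in \<open>A\<close> is a ring homomorphism.
\<close>

proposition pairing_sheafification: "pairing T A P.S Q.S \<Psi>"
proof (intro pairing.intro P.sheafification_module_sheaf Q.sheafification_module_sheaf
    pairing_axioms.intro sheafified_pairing_closed)
  fix U \<sigma> \<sigma>' \<tau>
  assume U: "openin T U" and s: "\<sigma> \<in> carrier (sec P.S U)" "\<sigma>' \<in> carrier (sec P.S U)"
    and t: "\<tau> \<in> carrier (sec Q.S U)"
  interpret UA: cring "sec A U" using U by (rule P.base.sec_cring)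
  show "\<Psi> U (\<sigma> \<oplus>\<^bsub>sec P.S U\<^esub> \<sigma>') \<tau> = \<Psi> U \<sigma> \<tau> \<oplus>\<^bsub>sec A U\<^esub> \<Psi> U \<sigma>' \<tau>"
  proof (rule sheafified_pairing_eqI[OF U], unfold is_value_def, intro conjI ballI)
    show "\<Psi> U \<sigma> \<tau> \<oplus>\<^bsub>sec A U\<^esub> \<Psi> U \<sigma>' \<tau> \<in> carrier (sec A U)"
      using sheafified_pairing_closed[OF U] s t by simp
    fix x assume x: "x \<in> U"
    obtain V1 p p' where V1: "x \<in> V1" "V1 \<subseteq> U" "P.represented \<sigma> V1 p" "P.represented \<sigma>' V1 p'"
      using P.sections_represented2[OF s x] .
    obtain V2 q where V2: "x \<in> V2" "V2 \<subseteq> U" "Q.represented \<tau> V2 q"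
      using Q.section_represented[OF t x] .
    let ?V = "V1 \<inter> V2"
    have o: "openin T ?V" using V1 V2 by (auto simp: P.represented_def Q.represented_def)
    obtain p p' q where r: "P.represented \<sigma> ?V p" "P.represented \<sigma>' ?V p'" "Q.represented \<tau> ?V q"
      using P.represented_res[OF V1(3) o] P.represented_res[OF V1(4) o] Q.represented_res[OF V2(3) o]
      by blast
    have V: "?V \<subseteq> U" using V1 by blast
    interpret h: ring_hom_cring "sec A U" "sec A ?V" "res A U ?V"
      using P.base.res_ring_hom_cring[OF U o V] .
    have "res A U ?V (\<Psi> U \<sigma> \<tau> \<oplus>\<^bsub>sec A U\<^esub> \<Psi> U \<sigma>' \<tau>) = \<phi> ?V p q \<oplus>\<^bsub>sec A ?V\<^esub> \<phi> ?V p' q"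
      using sheafified_pairing_closed[OF U] s t r
        sheafified_pairing_represented[OF U _ t V _ r(3)] by simp
    also have "\<dots> = \<phi> ?V (p \<oplus>\<^bsub>sec P ?V\<^esub> p') q"
      using r o by (intro add_left[symmetric]) (auto simp: P.represented_def Q.represented_def)
    finally show "\<exists>V p q. x \<in> V \<and> V \<subseteq> U \<and> P.represented (\<sigma> \<oplus>\<^bsub>sec P.S U\<^esub> \<sigma>') V p \<and>
        Q.represented \<tau> V q \<and> res A U V (\<Psi> U \<sigma> \<tau> \<oplus>\<^bsub>sec A U\<^esub> \<Psi> U \<sigma>' \<tau>) = \<phi> V p q"
      using V V1(1) V2(1) P.represented_add[OF r(1,2) V] r(3) by blast
  qed
next
  fix U \<sigma> \<tau> \<tau>'
  assume U: "openin T U" and s: "\<sigma> \<in> carrier (sec P.S U)"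
    and t: "\<tau> \<in> carrier (sec Q.S U)" "\<tau>' \<in> carrier (sec Q.S U)"
  interpret UA: cring "sec A U" using U by (rule P.base.sec_cring)
  show "\<Psi> U \<sigma> (\<tau> \<oplus>\<^bsub>sec Q.S U\<^esub> \<tau>') = \<Psi> U \<sigma> \<tau> \<oplus>\<^bsub>sec A U\<^esub> \<Psi> U \<sigma> \<tau>'"
  proof (rule sheafified_pairing_eqI[OF U], unfold is_value_def, intro conjI ballI)
    show "\<Psi> U \<sigma> \<tau> \<oplus>\<^bsub>sec A U\<^esub> \<Psi> U \<sigma> \<tau>' \<in> carrier (sec A U)"
      using sheafified_pairing_closed[OF U] s t by simp
    fix x assume x: "x \<in> U"
    obtain V1 q q' where V1: "x \<in> V1" "V1 \<subseteq> U" "Q.represented \<tau> V1 q" "Q.represented \<tau>' V1 q'"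
      using Q.sections_represented2[OF t x] .
    obtain V2 p where V2: "x \<in> V2" "V2 \<subseteq> U" "P.represented \<sigma> V2 p"
      using P.section_represented[OF s x] .
    let ?V = "V1 \<inter> V2"
    have o: "openin T ?V" using V1 V2 by (auto simp: P.represented_def Q.represented_def)
    obtain p q q' where r: "P.represented \<sigma> ?V p" "Q.represented \<tau> ?V q" "Q.represented \<tau>' ?V q'"
      using Q.represented_res[OF V1(3) o] Q.represented_res[OF V1(4) o] P.represented_res[OF V2(3) o]
      by blast
    have V: "?V \<subseteq> U" using V1 by blast
    interpret h: ring_hom_cring "sec A U" "sec A ?V" "res A U ?V"
      using P.base.res_ring_hom_cring[OF U o V] .
    have "res A U ?V (\<Psi> U \<sigma> \<tau> \<oplus>\<^bsub>sec A U\<^esub> \<Psi> U \<sigma> \<tau>') = \<phi> ?V p q \<oplus>\<^bsub>sec A ?V\<^esub> \<phi> ?V p q'"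
      using sheafified_pairing_closed[OF U] s t r
        sheafified_pairing_represented[OF U s _ V r(1)] by simp
    also have "\<dots> = \<phi> ?V p (q \<oplus>\<^bsub>sec Q ?V\<^esub> q')"
      using r o by (intro add_right[symmetric]) (auto simp: P.represented_def Q.represented_def)
    finally show "\<exists>V p q. x \<in> V \<and> V \<subseteq> U \<and> P.represented \<sigma> V p \<and>
        Q.represented (\<tau> \<oplus>\<^bsub>sec Q.S U\<^esub> \<tau>') V q \<and>
        res A U V (\<Psi> U \<sigma> \<tau> \<oplus>\<^bsub>sec A U\<^esub> \<Psi> U \<sigma> \<tau>') = \<phi> V p q"
      using V V1(1) V2(1) Q.represented_add[OF r(2,3) V] r(1) by blast
  qed
next
  fix U a \<sigma> \<tau>
  assume U: "openin T U" and a: "a \<in> carrier (sec A U)"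
    and s: "\<sigma> \<in> carrier (sec P.S U)" and t: "\<tau> \<in> carrier (sec Q.S U)"
  interpret UA: cring "sec A U" using U by (rule P.base.sec_cring)
  have *: "\<exists>V p q. x \<in> V \<and> V \<subseteq> U \<and> P.represented \<sigma> V p \<and> Q.represented \<tau> V q \<and>
      P.represented (a \<odot>\<^bsub>sec P.S U\<^esub> \<sigma>) V (res A U V a \<odot>\<^bsub>sec P V\<^esub> p) \<and>
      Q.represented (a \<odot>\<^bsub>sec Q.S U\<^esub> \<tau>) V (res A U V a \<odot>\<^bsub>sec Q V\<^esub> q) \<and>
      res A U V (a \<otimes>\<^bsub>sec A U\<^esub> \<Psi> U \<sigma> \<tau>) = \<phi> V (res A U V a \<odot>\<^bsub>sec P V\<^esub> p) q \<and>
      res A U V (a \<otimes>\<^bsub>sec A U\<^esub> \<Psi> U \<sigma> \<tau>) = \<phi> V p (res A U V a \<odot>\<^bsub>sec Q V\<^esub> q)"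
    if x: "x \<in> U" for x
  proof -
    obtain V p q where V: "x \<in> V" "V \<subseteq> U" and r: "P.represented \<sigma> V p" "Q.represented \<tau> V q"
      using sections_represented_pair[OF s t x] .
    have o: "openin T V" and p: "p \<in> carrier (sec P V)" and q: "q \<in> carrier (sec Q V)"
      using r by (auto simp: P.represented_def Q.represented_def)
    interpret h: ring_hom_cring "sec A U" "sec A V" "res A U V"
      using P.base.res_ring_hom_cring[OF U o V(2)] .
    have e: "res A U V (a \<otimes>\<^bsub>sec A U\<^esub> \<Psi> U \<sigma> \<tau>) = res A U V a \<otimes>\<^bsub>sec A V\<^esub> \<phi> V p q"
      using sheafified_pairing_closed[OF U s t] a sheafified_pairing_represented[OF U s t V(2) r] by simp
    show ?thesis
      using V r e P.represented_smult[OF r(1) V(2) U a] Q.represented_smult[OF r(2) V(2) U a]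
        smult_left[OF o _ p q, of "res A U V a"] smult_right[OF o _ p q, of "res A U V a"] a
      by (intro exI[of _ V] exI[of _ p] exI[of _ q]) simp
  qed
  have c: "a \<otimes>\<^bsub>sec A U\<^esub> \<Psi> U \<sigma> \<tau> \<in> carrier (sec A U)"
    using sheafified_pairing_closed[OF U s t] a by simp
  show "\<Psi> U (a \<odot>\<^bsub>sec P.S U\<^esub> \<sigma>) \<tau> = a \<otimes>\<^bsub>sec A U\<^esub> \<Psi> U \<sigma> \<tau>"
  proof (rule sheafified_pairing_eqI[OF U], unfold is_value_def, intro conjI ballI c)
    fix x assume "x \<in> U"
    then show "\<exists>V p q. x \<in> V \<and> V \<subseteq> U \<and> P.represented (a \<odot>\<^bsub>sec P.S U\<^esub> \<sigma>) V p \<and>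
        Q.represented \<tau> V q \<and> res A U V (a \<otimes>\<^bsub>sec A U\<^esub> \<Psi> U \<sigma> \<tau>) = \<phi> V p q"
      using *[of x] by blast
  qed
  show "\<Psi> U \<sigma> (a \<odot>\<^bsub>sec Q.S U\<^esub> \<tau>) = a \<otimes>\<^bsub>sec A U\<^esub> \<Psi> U \<sigma> \<tau>"
  proof (rule sheafified_pairing_eqI[OF U], unfold is_value_def, intro conjI ballI c)
    fix x assume "x \<in> U"
    then show "\<exists>V p q. x \<in> V \<and> V \<subseteq> U \<and> P.represented \<sigma> V p \<and>
        Q.represented (a \<odot>\<^bsub>sec Q.S U\<^esub> \<tau>) V q \<and> res A U V (a \<otimes>\<^bsub>sec A U\<^esub> \<Psi> U \<sigma> \<tau>) = \<phi> V p q"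
      using *[of x] by blast
  qed
next
  fix U V \<sigma> \<tau>
  assume U: "openin T U" and V: "openin T V" "V \<subseteq> U"
    and s: "\<sigma> \<in> carrier (sec P.S U)" and t: "\<tau> \<in> carrier (sec Q.S U)"
  have c: "\<Psi> U \<sigma> \<tau> \<in> carrier (sec A U)" using sheafified_pairing_closed[OF U s t] .
  show "res A U V (\<Psi> U \<sigma> \<tau>) = \<Psi> V (res P.S U V \<sigma>) (res Q.S U V \<tau>)"
    unfolding P.res_sheafification Q.res_sheafification
  proof (rule sheafified_pairing_eqI[OF V(1), symmetric], unfold is_value_def, intro conjI ballI)
    show "res A U V (\<Psi> U \<sigma> \<tau>) \<in> carrier (sec A V)"
      using c U V by (intro P.base.res_closed)
    fix x assume x: "x \<in> V"
    obtain W p q where W: "x \<in> W" "W \<subseteq> V" and r: "P.represented (restrict \<sigma> V) W p"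
      "Q.represented (restrict \<tau> V) W q"
      using sections_represented_pair[OF P.restrict_section_closed[OF V s]
          Q.restrict_section_closed[OF V t] x] .
    have o: "openin T W" using r by (auto simp: P.represented_def)
    have WU: "W \<subseteq> U" using W V by blast
    have "res A V W (res A U V (\<Psi> U \<sigma> \<tau>)) = res A U W (\<Psi> U \<sigma> \<tau>)"
      using P.base.res_comp[OF U V(1) o W(2) V(2) c] .
    also have "\<dots> = \<phi> W p q"
      using sheafified_pairing_represented[OF U s t WU] r
      by (simp add: P.represented_restrict[OF W(2)] Q.represented_restrict[OF W(2)])
    finally show "\<exists>W p q. x \<in> W \<and> W \<subseteq> V \<and> P.represented (restrict \<sigma> V) W p \<and>
        Q.represented (restrict \<tau> V) W q \<and> res A V W (res A U V (\<Psi> U \<sigma> \<tau>)) = \<phi> W p q"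
      using W r by blast
  qed
qed

end

lemma sheafified_pairing_flip:
  "sheafified_pairing T A Q P (\<lambda>U q p. \<phi> U p q) U \<tau> \<sigma> = sheafified_pairing T A P Q \<phi> U \<sigma> \<tau>"
proof -
  have "(\<exists>V q p. openin T V \<and> x \<in> V \<and> V \<subseteq> U \<and> q \<in> carrier (sec Q V) \<and> p \<in> carrier (sec P V) \<and>
      restrict \<tau> V = to_sheafification T Q V q \<and> restrict \<sigma> V = to_sheafification T P V p \<and>
      res A U V a = \<phi> V p q) =
    (\<exists>V p q. openin T V \<and> x \<in> V \<and> V \<subseteq> U \<and> p \<in> carrier (sec P V) \<and> q \<in> carrier (sec Q V) \<and>
      restrict \<sigma> V = to_sheafification T P V p \<and> restrict \<tau> V = to_sheafification T Q V q \<and>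
      res A U V a = \<phi> V p q)" for x a
    by (intro arg_cong[where f = Ex] ext, subst ex_comm, intro arg_cong[where f = Ex] ext) argo
  then show ?thesis unfolding sheafified_pairing_def by simp
qed

section \<open>Quotients by a subpresheaf\<close>

locale module_subpresheaf = presheaf_of_modules T A M
  for T :: "'x topology" and A :: "('x, 'r) algebra_presheaf"
    and M :: "('x, 'r, 'm) module_presheaf" +
  fixes N :: "'x set \<Rightarrow> 'm set"
  assumes sub: "openin T U \<Longrightarrow> submodule (N U) (sec A U) (sec M U)"
    and sub_res: "\<lbrakk>openin T U; openin T V; V \<subseteq> U; s \<in> N U\<rbrakk> \<Longrightarrow> res M U V s \<in> N V"
begin

abbreviation Q where "Q \<equiv> quotient_presheaf M N"

lemma sub_abelian_subgroup: "openin T U \<Longrightarrow> abelian_subgroup (N U) (sec M U)"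
  using sub sec_module
  by (intro abelian_subgroupI3) (auto simp: additive_subgroup_def submodule_def module_def)

lemma carrier_quotient: "carrier (sec Q U) = {N U +>\<^bsub>sec M U\<^esub> s |s. s \<in> carrier (sec M U)}"
  by (auto simp: quotient_presheaf_def A_RCOSETS_def')

lemma quotientE:
  assumes "C \<in> carrier (sec Q U)"
  obtains s where "s \<in> carrier (sec M U)" "C = N U +>\<^bsub>sec M U\<^esub> s"
  using assms unfolding carrier_quotient by blast

lemma coset_closed: "s \<in> carrier (sec M U) \<Longrightarrow> N U +>\<^bsub>sec M U\<^esub> s \<in> carrier (sec Q U)"
  unfolding carrier_quotient by blast

lemma in_cosetE:
  assumes "openin T U" "c \<in> N U +>\<^bsub>sec M U\<^esub> s" "s \<in> carrier (sec M U)"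
  obtains k where "k \<in> N U" "k \<in> carrier (sec M U)" "c = k \<oplus>\<^bsub>sec M U\<^esub> s"
proof -
  interpret abelian_subgroup "N U" "sec M U" using assms sub_abelian_subgroup by blast
  obtain k where "k \<in> N U" "c = k \<oplus>\<^bsub>sec M U\<^esub> s"
    using assms(2) unfolding a_r_coset_def' by blast
  then show ?thesis using that a_Hcarr by blast
qed

text \<open>
  Two representatives of a coset differ by an element of \<open>N U\<close>. This form of the statement makes the
  unions over a coset that define scalar multiplication and restriction collapse.
\<close>

lemma coset_eqI:
  assumes U: "openin T U" and k: "k \<in> N U" and s: "s \<in> carrier (sec M U)"
  shows "N U +>\<^bsub>sec M U\<^esub> (k \<oplus>\<^bsub>sec M U\<^esub> s) = N U +>\<^bsub>sec M U\<^esub> s"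
proof -
  interpret abelian_subgroup "N U" "sec M U" using U sub_abelian_subgroup by blast
  have "k \<oplus>\<^bsub>sec M U\<^esub> s \<in> N U +>\<^bsub>sec M U\<^esub> s" using k unfolding a_r_coset_def' by blast
  then show ?thesis using a_repr_independence'[OF _ s] by simp
qed

lemma coset_self: "\<lbrakk>openin T U; s \<in> carrier (sec M U)\<rbrakk> \<Longrightarrow> s \<in> N U +>\<^bsub>sec M U\<^esub> s"
  by (rule abelian_subgroup.a_rcos_self[OF sub_abelian_subgroup])

lemma quotient_zero:
  assumes "openin T U" shows "\<zero>\<^bsub>sec Q U\<^esub> = N U +>\<^bsub>sec M U\<^esub> \<zero>\<^bsub>sec M U\<^esub>"
proof -
  interpret abelian_subgroup "N U" "sec M U" using assms sub_abelian_subgroup by blast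
  show ?thesis using a_coset_add_zero a_subset by (simp add: quotient_presheaf_def)
qed

lemma coset_mem:
  assumes U: "openin T U" and k: "k \<in> N U"
  shows "N U +>\<^bsub>sec M U\<^esub> k = \<zero>\<^bsub>sec Q U\<^esub>"
proof -
  interpret abelian_subgroup "N U" "sec M U" using U sub_abelian_subgroup by blast
  show ?thesis using coset_eqI[OF U k zero_closed] k a_Hcarr quotient_zero[OF U] by simp
qed

lemma quotient_add:
  assumes "openin T U" "s \<in> carrier (sec M U)" "t \<in> carrier (sec M U)"
  shows "(N U +>\<^bsub>sec M U\<^esub> s) \<oplus>\<^bsub>sec Q U\<^esub> (N U +>\<^bsub>sec M U\<^esub> t) = N U +>\<^bsub>sec M U\<^esub> (s \<oplus>\<^bsub>sec M U\<^esub> t)"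
proof -
  interpret abelian_subgroup "N U" "sec M U" using assms sub_abelian_subgroup by blast
  show ?thesis using a_rcos_sum assms by (simp add: quotient_presheaf_def)
qed

lemma quotient_smult:
  assumes U: "openin T U" and a: "a \<in> carrier (sec A U)" and s: "s \<in> carrier (sec M U)"
  shows "a \<odot>\<^bsub>sec Q U\<^esub> (N U +>\<^bsub>sec M U\<^esub> s) = N U +>\<^bsub>sec M U\<^esub> (a \<odot>\<^bsub>sec M U\<^esub> s)"
proof -
  interpret module "sec A U" "sec M U" using U sec_module by blast
  interpret N: submodule "N U" "sec A U" "sec M U" using U sub by blast
  have "N U +>\<^bsub>sec M U\<^esub> (a \<odot>\<^bsub>sec M U\<^esub> c) = N U +>\<^bsub>sec M U\<^esub> (a \<odot>\<^bsub>sec M U\<^esub> s)"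
    if c: "c \<in> N U +>\<^bsub>sec M U\<^esub> s" for c
  proof -
    obtain k where k: "k \<in> N U" "k \<in> carrier (sec M U)" "c = k \<oplus>\<^bsub>sec M U\<^esub> s"
      using in_cosetE[OF U c s] .
    then show ?thesis
      using coset_eqI[OF U N.smult_closed[OF a k(1)]] a s by (simp add: smult_r_distr)
  qed
  then have "(\<Union>c\<in>N U +>\<^bsub>sec M U\<^esub> s. N U +>\<^bsub>sec M U\<^esub> (a \<odot>\<^bsub>sec M U\<^esub> c)) =
      (\<Union>c\<in>N U +>\<^bsub>sec M U\<^esub> s. N U +>\<^bsub>sec M U\<^esub> (a \<odot>\<^bsub>sec M U\<^esub> s))"
    by (rule SUP_cong[OF refl])
  also have "\<dots> = N U +>\<^bsub>sec M U\<^esub> (a \<odot>\<^bsub>sec M U\<^esub> s)"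
    using coset_self[OF U s] by blast
  finally show ?thesis by (simp add: quotient_presheaf_def)
qed

lemma quotient_res:
  assumes U: "openin T U" and V: "openin T V" "V \<subseteq> U" and s: "s \<in> carrier (sec M U)"
  shows "res Q U V (N U +>\<^bsub>sec M U\<^esub> s) = N V +>\<^bsub>sec M V\<^esub> res M U V s"
proof -
  have "N V +>\<^bsub>sec M V\<^esub> res M U V c = N V +>\<^bsub>sec M V\<^esub> res M U V s"
    if c: "c \<in> N U +>\<^bsub>sec M U\<^esub> s" for c
  proof -
    obtain k where k: "k \<in> N U" "k \<in> carrier (sec M U)" "c = k \<oplus>\<^bsub>sec M U\<^esub> s"
      using in_cosetE[OF U c s] .
    then show ?thesis
      using coset_eqI[OF V(1) sub_res[OF U V k(1)]] s U V by (simp add: res_add res_closed)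
  qed
  then have "(\<Union>c\<in>N U +>\<^bsub>sec M U\<^esub> s. N V +>\<^bsub>sec M V\<^esub> res M U V c) =
      (\<Union>c\<in>N U +>\<^bsub>sec M U\<^esub> s. N V +>\<^bsub>sec M V\<^esub> res M U V s)"
    by (rule SUP_cong[OF refl])
  also have "\<dots> = N V +>\<^bsub>sec M V\<^esub> res M U V s"
    using coset_self[OF U s] by blast
  finally show ?thesis by (simp add: quotient_presheaf_def)
qed

proposition quotient_presheaf_of_modules: "presheaf_of_modules T A Q"
proof (intro presheaf_of_modules.intro set_presheaf.intro presheaf_of_modules_axioms.intro
    base.algebraized_space_axioms)
  fix U V C D assume U: "openin T U" and V: "openin T V" "V \<subseteq> U" and C: "C \<in> carrier (sec Q U)"
  obtain s where s: "s \<in> carrier (sec M U)" "C = N U +>\<^bsub>sec M U\<^esub> s" using C by (rule quotientE)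
  show "res Q U V C \<in> carrier (sec Q V)"
    using s U V by (auto simp: quotient_res res_closed intro: coset_closed)
  {
    fix W assume W: "openin T W" "W \<subseteq> V"
    then show "res Q V W (res Q U V C) = res Q U W C"
      using s U V by (simp add: quotient_res res_closed res_comp)
  }
  {
    fix D assume D: "D \<in> carrier (sec Q U)"
    obtain t where t: "t \<in> carrier (sec M U)" "D = N U +>\<^bsub>sec M U\<^esub> t" using D by (rule quotientE)
    interpret module "sec A U" "sec M U" using U sec_module by blast
    show "res Q U V (C \<oplus>\<^bsub>sec Q U\<^esub> D) = res Q U V C \<oplus>\<^bsub>sec Q V\<^esub> res Q U V D"
      using s t U V by (simp add: quotient_add quotient_res res_add res_closed)
  }
  {
    fix a assume a: "a \<in> carrier (sec A U)"
    interpret module "sec A U" "sec M U" using U sec_module by blast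
    show "res Q U V (a \<odot>\<^bsub>sec Q U\<^esub> C) = res A U V a \<odot>\<^bsub>sec Q V\<^esub> res Q U V C"
      using s a U V by (simp add: quotient_smult quotient_res res_smult res_closed base.res_closed)
  }
next
  fix U C assume U: "openin T U" and C: "C \<in> carrier (sec Q U)"
  then show "res Q U U C = C"
    by (auto simp: carrier_quotient quotient_res res_id)
next
  fix U assume U: "openin T U"
  interpret module "sec A U" "sec M U" using U sec_module by blast
  note q = quotient_add[OF U] quotient_smult[OF U] quotient_zero[OF U]
  show "module (sec A U) (sec Q U)"
  proof (rule moduleI)
    show "cring (sec A U)" using U by (rule base.sec_cring)
    show "abelian_group (sec Q U)"
    proof (rule abelian_groupI)
      fix C D assume C: "C \<in> carrier (sec Q U)" and D: "D \<in> carrier (sec Q U)"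
      obtain s where s: "s \<in> carrier (sec M U)" "C = N U +>\<^bsub>sec M U\<^esub> s" using C by (rule quotientE)
      obtain t where t: "t \<in> carrier (sec M U)" "D = N U +>\<^bsub>sec M U\<^esub> t" using D by (rule quotientE)
      show "C \<oplus>\<^bsub>sec Q U\<^esub> D \<in> carrier (sec Q U)"
        using s t by (simp add: q coset_closed)
      show "C \<oplus>\<^bsub>sec Q U\<^esub> D = D \<oplus>\<^bsub>sec Q U\<^esub> C"
        using s t by (simp add: q M.a_comm)
      fix E assume E: "E \<in> carrier (sec Q U)"
      obtain r where r: "r \<in> carrier (sec M U)" "E = N U +>\<^bsub>sec M U\<^esub> r" using E by (rule quotientE)
      show "(C \<oplus>\<^bsub>sec Q U\<^esub> D) \<oplus>\<^bsub>sec Q U\<^esub> E = C \<oplus>\<^bsub>sec Q U\<^esub> (D \<oplus>\<^bsub>sec Q U\<^esub> E)"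
        using s t r by (simp add: q M.a_assoc)
    next
      fix C assume C: "C \<in> carrier (sec Q U)"
      obtain s where s: "s \<in> carrier (sec M U)" "C = N U +>\<^bsub>sec M U\<^esub> s" using C by (rule quotientE)
      show "\<zero>\<^bsub>sec Q U\<^esub> \<oplus>\<^bsub>sec Q U\<^esub> C = C"
        using s by (simp add: q)
      show "\<exists>D\<in>carrier (sec Q U). D \<oplus>\<^bsub>sec Q U\<^esub> C = \<zero>\<^bsub>sec Q U\<^esub>"
        using s by (intro bexI[of _ "N U +>\<^bsub>sec M U\<^esub> (\<ominus>\<^bsub>sec M U\<^esub> s)"] coset_closed)
          (simp_all add: q M.l_neg)
    qed (simp add: q coset_closed)
  next
    fix a C assume a: "a \<in> carrier (sec A U)" and C: "C \<in> carrier (sec Q U)"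
    obtain s where s: "s \<in> carrier (sec M U)" "C = N U +>\<^bsub>sec M U\<^esub> s" using C by (rule quotientE)
    show "a \<odot>\<^bsub>sec Q U\<^esub> C \<in> carrier (sec Q U)" using s a by (simp add: q coset_closed)
    {
      fix b assume "b \<in> carrier (sec A U)"
      then show "(a \<oplus>\<^bsub>sec A U\<^esub> b) \<odot>\<^bsub>sec Q U\<^esub> C = a \<odot>\<^bsub>sec Q U\<^esub> C \<oplus>\<^bsub>sec Q U\<^esub> b \<odot>\<^bsub>sec Q U\<^esub> C"
        and "(a \<otimes>\<^bsub>sec A U\<^esub> b) \<odot>\<^bsub>sec Q U\<^esub> C = a \<odot>\<^bsub>sec Q U\<^esub> (b \<odot>\<^bsub>sec Q U\<^esub> C)"
        using s a by (simp_all add: q smult_l_distr smult_assoc1)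
    }
    fix D assume D: "D \<in> carrier (sec Q U)"
    obtain t where t: "t \<in> carrier (sec M U)" "D = N U +>\<^bsub>sec M U\<^esub> t" using D by (rule quotientE)
    show "a \<odot>\<^bsub>sec Q U\<^esub> (C \<oplus>\<^bsub>sec Q U\<^esub> D) = a \<odot>\<^bsub>sec Q U\<^esub> C \<oplus>\<^bsub>sec Q U\<^esub> a \<odot>\<^bsub>sec Q U\<^esub> D"
      using s t a by (simp add: q smult_r_distr)
  next
    fix C assume C: "C \<in> carrier (sec Q U)"
    obtain s where s: "s \<in> carrier (sec M U)" "C = N U +>\<^bsub>sec M U\<^esub> s" using C by (rule quotientE)
    show "\<one>\<^bsub>sec A U\<^esub> \<odot>\<^bsub>sec Q U\<^esub> C = C" using s by (simp add: q)
  qed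
qed

end

section \<open>Morphisms and free sheaves\<close>

definition unit_vector :: "('r, 'b) ring_scheme \<Rightarrow> nat \<Rightarrow> nat \<Rightarrow> nat \<Rightarrow> 'r" where
  "unit_vector R n j = (\<lambda>i\<in>{..<n}. if i = j then \<one>\<^bsub>R\<^esub> else \<zero>\<^bsub>R\<^esub>)"

lemma (in cring) unit_vector_closed: "unit_vector R n j \<in> {..<n} \<rightarrow>\<^sub>E carrier R"
  by (auto simp: unit_vector_def)

text \<open>
  An additive and homogeneous function on \<open>R\<^sup>n\<close> is determined by its values on the unit vectors. The
  induction adds the coordinates of \<open>v\<close> one at a time.
\<close>

lemma (in cring) linear_form_expansion:
  assumes closed: "g \<in> ({..<n} \<rightarrow>\<^sub>E carrier R) \<rightarrow> carrier R"
    and add: "\<And>f f'. \<lbrakk>f \<in> {..<n} \<rightarrow>\<^sub>E carrier R; f' \<in> {..<n} \<rightarrow>\<^sub>E carrier R\<rbrakk>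
      \<Longrightarrow> g (\<lambda>i\<in>{..<n}. f i \<oplus> f' i) = g f \<oplus> g f'"
    and smult: "\<And>a f. \<lbrakk>a \<in> carrier R; f \<in> {..<n} \<rightarrow>\<^sub>E carrier R\<rbrakk>
      \<Longrightarrow> g (\<lambda>i\<in>{..<n}. a \<otimes> f i) = a \<otimes> g f"
    and v: "v \<in> {..<n} \<rightarrow>\<^sub>E carrier R"
  shows "g v = (\<Oplus>j\<in>{..<n}. v j \<otimes> g (unit_vector R n j))"
proof -
  have vc: "v i \<in> carrier R" if "i < n" for i using v that by (auto simp: PiE_iff)
  have uc: "g (unit_vector R n j) \<in> carrier R" for j
    using closed unit_vector_closed by (rule funcset_mem)
  let ?v = "\<lambda>k. \<lambda>i\<in>{..<n}. if i < k then v i else \<zero>"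
  have "g (?v k) = (\<Oplus>j\<in>{..<k}. v j \<otimes> g (unit_vector R n j))" if "k \<le> n" for k
    using that
  proof (induction k)
    case 0
    have z: "(\<lambda>i\<in>{..<n}. \<zero>) \<in> {..<n} \<rightarrow>\<^sub>E carrier R" by auto
    have "(\<lambda>i\<in>{..<n}. \<zero> \<otimes> (\<lambda>i\<in>{..<n}. \<zero>) i) = (\<lambda>i\<in>{..<n}. \<zero>)"
      by (rule restrict_ext) simp
    then have "g (\<lambda>i\<in>{..<n}. \<zero>) = \<zero> \<otimes> g (\<lambda>i\<in>{..<n}. \<zero>)"
      using smult[OF zero_closed z] by simp
    also have "\<dots> = \<zero>" using funcset_mem[OF closed z] by simp
    finally show ?case by (simp only: not_less0 if_False lessThan_0 finsum_empty)
  next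
    case (Suc k)
    have k: "?v k \<in> {..<n} \<rightarrow>\<^sub>E carrier R" using vc by auto
    have ku: "(\<lambda>i\<in>{..<n}. v k \<otimes> unit_vector R n k i) \<in> {..<n} \<rightarrow>\<^sub>E carrier R"
      using vc Suc.prems by (auto simp: unit_vector_def)
    have "?v (Suc k) = (\<lambda>i\<in>{..<n}. (\<lambda>i\<in>{..<n}. v k \<otimes> unit_vector R n k i) i \<oplus> ?v k i)"
      using vc Suc.prems by (intro restrict_ext) (auto simp: unit_vector_def less_Suc_eq)
    then have "g (?v (Suc k)) = v k \<otimes> g (unit_vector R n k) \<oplus> g (?v k)"
      using add[OF ku k] smult[OF vc unit_vector_closed] Suc.prems by simp
    moreover have "(\<Oplus>j\<in>{..<Suc k}. v j \<otimes> g (unit_vector R n j)) =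
        v k \<otimes> g (unit_vector R n k) \<oplus> (\<Oplus>j\<in>{..<k}. v j \<otimes> g (unit_vector R n j))"
      unfolding lessThan_Suc using vc uc Suc.prems by (intro finsum_insert) auto
    ultimately show ?case by (simp only: Suc.IH[OF Suc_leD[OF Suc.prems]])
  qed
  moreover have "?v n = v"
    using v by (intro extensionalityI[of _ "{..<n}"]) (auto simp: PiE_iff)
  ultimately show ?thesis by (metis le_refl)
qed

definition linear_form :: "('r, 'b) ring_scheme \<Rightarrow> ('r, 'm, 'c) module_scheme \<Rightarrow> ('m \<Rightarrow> 'r) \<Rightarrow> bool"
  where "linear_form R M h \<longleftrightarrow> h \<in> carrier M \<rightarrow> carrier R \<and>
    (\<forall>s\<in>carrier M. \<forall>t\<in>carrier M. h (s \<oplus>\<^bsub>M\<^esub> t) = h s \<oplus>\<^bsub>R\<^esub> h t) \<and>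
    (\<forall>a\<in>carrier R. \<forall>s\<in>carrier M. h (a \<odot>\<^bsub>M\<^esub> s) = a \<otimes>\<^bsub>R\<^esub> h s)"

context
  fixes T :: "'x topology" and A :: "('x, 'r) algebra_presheaf"
    and M :: "('x, 'r, 'm) module_presheaf" and N :: "('x, 'r, 'n) module_presheaf" and \<phi>
  assumes \<phi>: "sheaf_morphism T A M N \<phi>"
begin

lemma sheaf_morphism_closed:
  "\<lbrakk>openin T U; s \<in> carrier (sec M U)\<rbrakk> \<Longrightarrow> \<phi> U s \<in> carrier (sec N U)"
  using \<phi> unfolding sheaf_morphism_def by (simp add: Pi_iff)

lemma sheaf_morphism_add:
  "\<lbrakk>openin T U; s \<in> carrier (sec M U); t \<in> carrier (sec M U)\<rbrakk>
    \<Longrightarrow> \<phi> U (s \<oplus>\<^bsub>sec M U\<^esub> t) = \<phi> U s \<oplus>\<^bsub>sec N U\<^esub> \<phi> U t"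
  using \<phi> unfolding sheaf_morphism_def by simp

lemma sheaf_morphism_smult:
  "\<lbrakk>openin T U; a \<in> carrier (sec A U); s \<in> carrier (sec M U)\<rbrakk>
    \<Longrightarrow> \<phi> U (a \<odot>\<^bsub>sec M U\<^esub> s) = a \<odot>\<^bsub>sec N U\<^esub> \<phi> U s"
  using \<phi> unfolding sheaf_morphism_def by simp

lemma sheaf_morphism_natural:
  "\<lbrakk>openin T U; openin T V; V \<subseteq> U; s \<in> carrier (sec M U)\<rbrakk>
    \<Longrightarrow> \<phi> V (res M U V s) = res N U V (\<phi> U s)"
  using \<phi> unfolding sheaf_morphism_def by simp

end

lemma sheaf_isomorphicE:
  assumes "sheaf_isomorphic T A M N"
  obtains \<phi> \<psi> where "sheaf_morphism T A M N \<phi>" "sheaf_morphism T A N M \<psi>"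
    and "\<And>U s. \<lbrakk>openin T U; s \<in> carrier (sec M U)\<rbrakk> \<Longrightarrow> \<psi> U (\<phi> U s) = s"
    and "\<And>U t. \<lbrakk>openin T U; t \<in> carrier (sec N U)\<rbrakk> \<Longrightarrow> \<phi> U (\<psi> U t) = t"
proof -
  obtain \<phi> \<psi> where *: "sheaf_morphism T A M N \<phi> \<and> sheaf_morphism T A N M \<psi> \<and>
      (\<forall>U. openin T U \<longrightarrow>
        (\<forall>s\<in>carrier (sec M U). \<psi> U (\<phi> U s) = s) \<and>
        (\<forall>t\<in>carrier (sec N U). \<phi> U (\<psi> U t) = t))"
    using assms unfolding sheaf_isomorphic_def by (elim exE)
  show ?thesis by (rule that[of \<phi> \<psi>]) (simp_all add: *)
qed

lemma sheaf_isomorphicI: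
  assumes "sheaf_morphism T A M N \<phi>" "sheaf_morphism T A N M \<psi>"
    and "\<And>U s. \<lbrakk>openin T U; s \<in> carrier (sec M U)\<rbrakk> \<Longrightarrow> \<psi> U (\<phi> U s) = s"
    and "\<And>U t. \<lbrakk>openin T U; t \<in> carrier (sec N U)\<rbrakk> \<Longrightarrow> \<phi> U (\<psi> U t) = t"
  shows "sheaf_isomorphic T A M N"
  unfolding sheaf_isomorphic_def
  by (rule exI[of _ \<phi>], rule exI[of _ \<psi>]) (simp add: assms)

lemma sheaf_isomorphic_sym:
  assumes "sheaf_isomorphic T A M N"
  shows "sheaf_isomorphic T A N M"
  using assms by (rule sheaf_isomorphicE) (rule sheaf_isomorphicI)

lemma carrier_free_sheaf: "carrier (sec (free_sheaf A n) U) = {..<n} \<rightarrow>\<^sub>E carrier (sec A U)"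
  by (simp add: free_sheaf_def)

lemma (in algebraized_space) linear_form_free_expansion:
  assumes U: "openin T U" and \<psi>: "sheaf_morphism T A (free_sheaf A n) M \<psi>"
    and h: "linear_form (sec A U) (sec M U) h" and v: "v \<in> {..<n} \<rightarrow>\<^sub>E carrier (sec A U)"
  shows "h (\<psi> U v) =
    (\<Oplus>\<^bsub>sec A U\<^esub>j\<in>{..<n}. v j \<otimes>\<^bsub>sec A U\<^esub> h (\<psi> U (unit_vector (sec A U) n j)))"
proof -
  interpret cring "sec A U" using U by (rule sec_cring)
  have \<psi>c: "\<psi> U f \<in> carrier (sec M U)" if "f \<in> {..<n} \<rightarrow>\<^sub>E carrier (sec A U)" for f
    using sheaf_morphism_closed[OF \<psi> U] that unfolding carrier_free_sheaf .
  show ?thesis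
  proof (rule linear_form_expansion[where g = "\<lambda>f. h (\<psi> U f)", OF _ _ _ v])
    show "(\<lambda>f. h (\<psi> U f)) \<in> ({..<n} \<rightarrow>\<^sub>E carrier (sec A U)) \<rightarrow> carrier (sec A U)"
      using \<psi>c h unfolding linear_form_def by blast
  next
    fix f f' assume f: "f \<in> {..<n} \<rightarrow>\<^sub>E carrier (sec A U)" "f' \<in> {..<n} \<rightarrow>\<^sub>E carrier (sec A U)"
    have "\<psi> U (f \<oplus>\<^bsub>sec (free_sheaf A n) U\<^esub> f') = \<psi> U f \<oplus>\<^bsub>sec M U\<^esub> \<psi> U f'"
      using sheaf_morphism_add[OF \<psi> U] f unfolding carrier_free_sheaf .
    then show "h (\<psi> U (\<lambda>i\<in>{..<n}. f i \<oplus>\<^bsub>sec A U\<^esub> f' i)) = h (\<psi> U f) \<oplus>\<^bsub>sec A U\<^esub> h (\<psi> U f')"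
      using h \<psi>c f unfolding linear_form_def by (simp add: free_sheaf_def)
  next
    fix a f assume a: "a \<in> carrier (sec A U)" and f: "f \<in> {..<n} \<rightarrow>\<^sub>E carrier (sec A U)"
    have "\<psi> U (a \<odot>\<^bsub>sec (free_sheaf A n) U\<^esub> f) = a \<odot>\<^bsub>sec M U\<^esub> \<psi> U f"
      using sheaf_morphism_smult[OF \<psi> U a] f unfolding carrier_free_sheaf .
    then show "h (\<psi> U (\<lambda>i\<in>{..<n}. a \<otimes>\<^bsub>sec A U\<^esub> f i)) = a \<otimes>\<^bsub>sec A U\<^esub> h (\<psi> U f)"
      using h \<psi>c f a unfolding linear_form_def by (simp add: free_sheaf_def)
  qed
qed

lemma (in algebraized_space) free_sheaf_res_unit_vector:
  assumes "openin T U" "openin T V" "V \<subseteq> U"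
  shows "res (free_sheaf A n) U V (unit_vector (sec A U) n j) = unit_vector (sec A V) n j"
proof -
  interpret h: ring_hom_cring "sec A U" "sec A V" "res A U V"
    using assms by (rule res_ring_hom_cring)
  show ?thesis by (auto simp: free_sheaf_def unit_vector_def fun_eq_iff)
qed

text \<open>
  The sections \<open>e j\<close> are the images of the unit vectors over the whole space. Restriction maps unit
  vectors to unit vectors, so over each open set the restrictions of the \<open>e j\<close> generate the module of
  sections. Generation is only ever used to show that a linear form vanishes, and it is stated in
  that form.
\<close>

lemma (in algebraized_space) free_generators:
  assumes free: "free_of_rank T A M n"
  obtains e where "\<And>j. e j \<in> carrier (sec M (topspace T))"
    and "\<And>U h s. \<lbrakk>openin T U; linear_form (sec A U) (sec M U) h;
      \<And>j. j < n \<Longrightarrow> h (res M (topspace T) U (e j)) = \<zero>\<^bsub>sec A U\<^esub>; s \<in> carrier (sec M U)\<rbrakk>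
      \<Longrightarrow> h s = \<zero>\<^bsub>sec A U\<^esub>"
proof -
  let ?X = "topspace T"
  have "sheaf_isomorphic T A M (free_sheaf A n)" using free by (simp add: free_of_rank_def)
  then obtain \<phi> \<psi> where \<phi>: "sheaf_morphism T A M (free_sheaf A n) \<phi>"
    and \<psi>: "sheaf_morphism T A (free_sheaf A n) M \<psi>"
    and inv: "\<And>U s. \<lbrakk>openin T U; s \<in> carrier (sec M U)\<rbrakk> \<Longrightarrow> \<psi> U (\<phi> U s) = s"
    by (rule sheaf_isomorphicE) (rule that)
  interpret X: cring "sec A ?X" by (rule sec_cring) simp
  let ?e = "\<lambda>j. \<psi> ?X (unit_vector (sec A ?X) n j)"
  have uc: "unit_vector (sec A ?X) n j \<in> carrier (sec (free_sheaf A n) ?X)" for j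
    unfolding carrier_free_sheaf by (rule X.unit_vector_closed)
  show thesis
  proof (rule that[of ?e])
    show "?e j \<in> carrier (sec M ?X)" for j
      using sheaf_morphism_closed[OF \<psi> openin_topspace uc] .
  next
    fix U h s
    assume U: "openin T U" and h: "linear_form (sec A U) (sec M U) h"
      and z: "\<And>j. j < n \<Longrightarrow> h (res M ?X U (?e j)) = \<zero>\<^bsub>sec A U\<^esub>" and s: "s \<in> carrier (sec M U)"
    interpret U: cring "sec A U" using U by (rule sec_cring)
    have UX: "U \<subseteq> ?X" using U by (rule openin_subset)
    have "\<psi> U (res (free_sheaf A n) ?X U (unit_vector (sec A ?X) n j)) = res M ?X U (?e j)" for j
      using sheaf_morphism_natural[OF \<psi> openin_topspace U UX uc] .
    then have e: "\<psi> U (unit_vector (sec A U) n j) = res M ?X U (?e j)" for j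
      using free_sheaf_res_unit_vector[OF openin_topspace U UX] by simp
    have \<phi>s: "\<phi> U s \<in> {..<n} \<rightarrow>\<^sub>E carrier (sec A U)"
      using sheaf_morphism_closed[OF \<phi> U s] unfolding carrier_free_sheaf .
    have "h s = h (\<psi> U (\<phi> U s))" using inv[OF U s] by simp
    also have "\<dots> = (\<Oplus>\<^bsub>sec A U\<^esub>j\<in>{..<n}. \<phi> U s j \<otimes>\<^bsub>sec A U\<^esub> h (res M ?X U (?e j)))"
      using linear_form_free_expansion[OF U \<psi> h \<phi>s] by (simp add: e)
    also have "\<dots> = (\<Oplus>\<^bsub>sec A U\<^esub>j\<in>{..<n}. \<zero>\<^bsub>sec A U\<^esub>)"
      using z \<phi>s by (intro U.finsum_cong') (auto simp: PiE_iff)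
    finally show "h s = \<zero>\<^bsub>sec A U\<^esub>" by simp
  qed
qed

lemma sheaf_morphism_comp:
  assumes "sheaf_morphism T A M N \<phi>" "sheaf_morphism T A N L \<psi>"
  shows "sheaf_morphism T A M L (\<lambda>U s. \<psi> U (\<phi> U s))"
proof -
  note c = sheaf_morphism_closed[OF assms(1)]
  show ?thesis unfolding sheaf_morphism_def
    using c sheaf_morphism_closed[OF assms(2)]
    by (auto simp: sheaf_morphism_add[OF assms(1)] sheaf_morphism_add[OF assms(2)]
        sheaf_morphism_smult[OF assms(1)] sheaf_morphism_smult[OF assms(2)]
        sheaf_morphism_natural[OF assms(1)] sheaf_morphism_natural[OF assms(2)])
qed

lemma sheaf_isomorphic_trans:
  assumes "sheaf_isomorphic T A M N" "sheaf_isomorphic T A N L"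
  shows "sheaf_isomorphic T A M L"
proof -
  obtain \<phi> \<psi> where 1: "sheaf_morphism T A M N \<phi>" "sheaf_morphism T A N M \<psi>"
    "\<And>U s. \<lbrakk>openin T U; s \<in> carrier (sec M U)\<rbrakk> \<Longrightarrow> \<psi> U (\<phi> U s) = s"
    "\<And>U t. \<lbrakk>openin T U; t \<in> carrier (sec N U)\<rbrakk> \<Longrightarrow> \<phi> U (\<psi> U t) = t"
    using assms(1) by (rule sheaf_isomorphicE) (rule that)
  obtain \<phi>' \<psi>' where 2: "sheaf_morphism T A N L \<phi>'" "sheaf_morphism T A L N \<psi>'"
    "\<And>U s. \<lbrakk>openin T U; s \<in> carrier (sec N U)\<rbrakk> \<Longrightarrow> \<psi>' U (\<phi>' U s) = s"
    "\<And>U t. \<lbrakk>openin T U; t \<in> carrier (sec L U)\<rbrakk> \<Longrightarrow> \<phi>' U (\<psi>' U t) = t"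
    using assms(2) by (rule sheaf_isomorphicE) (rule that)
  note closed = sheaf_morphism_closed[OF 1(1)] sheaf_morphism_closed[OF 2(2)]
  show ?thesis
    using sheaf_morphism_comp[OF 1(1) 2(1)] sheaf_morphism_comp[OF 2(2) 1(2)]
    by (rule sheaf_isomorphicI) (simp_all add: 1(3,4) 2(3,4) closed)
qed

text \<open>
  Restriction is a homomorphism of rings with unit, so \<open>1 = 0\<close> in the ring of global sections forces
  \<open>1 = 0\<close> in every ring \<open>A(U)\<close>.
\<close>

lemma (in module_sheaf) sections_trivial:
  assumes U: "openin T U" and one: "\<one>\<^bsub>sec A (topspace T)\<^esub> = \<zero>\<^bsub>sec A (topspace T)\<^esub>"
    and s: "s \<in> carrier (sec M U)"
  shows "s = \<zero>\<^bsub>sec M U\<^esub>"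
proof -
  interpret module "sec A U" "sec M U" using U by (rule sec_module)
  interpret h: ring_hom_cring "sec A (topspace T)" "sec A U" "res A (topspace T) U"
    using U by (intro base.res_ring_hom_cring) (auto simp: openin_subset)
  have "\<one>\<^bsub>sec A U\<^esub> = \<zero>\<^bsub>sec A U\<^esub>" using h.hom_one h.hom_zero one by simp
  then have "\<one>\<^bsub>sec A U\<^esub> \<odot>\<^bsub>sec M U\<^esub> s = \<zero>\<^bsub>sec A U\<^esub> \<odot>\<^bsub>sec M U\<^esub> s" by simp
  then show ?thesis using s by simp
qed

lemma zero_sheaves_isomorphic:
  assumes "module_sheaf T A M" "module_sheaf T A N"
    and "\<And>U s. openin T U \<Longrightarrow> s \<in> carrier (sec M U) \<Longrightarrow> s = \<zero>\<^bsub>sec M U\<^esub>"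
    and "\<And>U s. openin T U \<Longrightarrow> s \<in> carrier (sec N U) \<Longrightarrow> s = \<zero>\<^bsub>sec N U\<^esub>"
  shows "sheaf_isomorphic T A M N"
proof -
  have zero_morphism: "sheaf_morphism T A M N (\<lambda>U s. \<zero>\<^bsub>sec N U\<^esub>)"
    if "module_sheaf T A N" for M :: "('a, 'b, 'm) module_presheaf" and N :: "('a, 'b, 'n) module_presheaf"
  proof -
    interpret N: module_sheaf T A N by fact
    show ?thesis unfolding sheaf_morphism_def
    proof (intro conjI allI impI)
      fix U assume U: "openin T U"
      interpret module "sec A U" "sec N U" using U by (rule N.sec_module)
      show "(\<lambda>s. \<zero>\<^bsub>sec N U\<^esub>) \<in> carrier (sec M U) \<rightarrow> carrier (sec N U)"
        and "\<forall>s\<in>carrier (sec M U). \<forall>t\<in>carrier (sec M U). \<zero>\<^bsub>sec N U\<^esub> = \<zero>\<^bsub>sec N U\<^esub> \<oplus>\<^bsub>sec N U\<^esub> \<zero>\<^bsub>sec N U\<^esub>"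
        and "\<forall>a\<in>carrier (sec A U). \<forall>s\<in>carrier (sec M U). \<zero>\<^bsub>sec N U\<^esub> = a \<odot>\<^bsub>sec N U\<^esub> \<zero>\<^bsub>sec N U\<^esub>"
        by auto
    qed (simp add: N.presheaf.res_zero)
  qed
  show ?thesis
    using zero_morphism[OF assms(2)] zero_morphism[OF assms(1)]
    by (rule sheaf_isomorphicI) (simp_all add: assms(3,4)[symmetric])
qed

section \<open>Kernels of a pairing\<close>

context pairing
begin

text \<open>
  Exchanging the two arguments turns right orthogonals into left ones, so that only left kernels have
  to be studied.
\<close>

lemma flip: "pairing T A E F (\<lambda>U s t. \<Phi> U t s)"
  by (intro pairing.intro pairing_axioms.intro E.module_sheaf_axioms F.module_sheaf_axioms)
    (rule closed add_left add_right smult_left smult_right natural; assumption)+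

lemma zero_left:
  assumes "openin T U" "s \<in> carrier (sec E U)"
  shows "\<Phi> U \<zero>\<^bsub>sec F U\<^esub> s = \<zero>\<^bsub>sec A U\<^esub>"
proof -
  interpret A: cring "sec A U" using assms F.base.sec_cring by blast
  interpret F': module "sec A U" "sec F U" using assms F.sec_module by blast
  show ?thesis
    using smult_left[OF assms(1) A.zero_closed F'.zero_closed assms(2)] closed[OF assms(1) F'.zero_closed assms(2)]
    by simp
qed

lemma linear_form_right: "\<lbrakk>openin T U; t \<in> carrier (sec F U)\<rbrakk> \<Longrightarrow> linear_form (sec A U) (sec E U) (\<Phi> U t)"
  unfolding linear_form_def using closed add_right smult_right by simp

lemma linear_form_left:
  "\<lbrakk>openin T U; s \<in> carrier (sec E U)\<rbrakk> \<Longrightarrow> linear_form (sec A U) (sec F U) (\<lambda>t. \<Phi> U t s)"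
  unfolding linear_form_def using closed add_left smult_left by simp

text \<open>
  If \<open>t\<close> is locally orthogonal to \<open>E\<close>, then for every section \<open>s\<close> of \<open>E\<close> over \<open>U\<close> the section \<open>\<Phi> U t s\<close> of \<open>A\<close>
  vanishes locally, hence vanishes by locality in \<open>A\<close>.
\<close>

lemma left_kernel_eq_orthogonal:
  assumes U: "openin T U"
  shows "left_kernel T A F E \<Phi> U = left_orthogonal A F E \<Phi> U"
proof
  show "left_orthogonal A F E \<Phi> U \<subseteq> left_kernel T A F E \<Phi> U"
    using U F.res_id[OF U] unfolding left_kernel_def generated_submodule_def left_orthogonal_def
    by (auto intro!: exI[of _ U])
  show "left_kernel T A F E \<Phi> U \<subseteq> left_orthogonal A F E \<Phi> U"
  proof
    fix t assume "t \<in> left_kernel T A F E \<Phi> U"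
    then have t: "t \<in> carrier (sec F U)" and loc: "\<And>x. x \<in> U \<Longrightarrow>
        \<exists>V. openin T V \<and> x \<in> V \<and> V \<subseteq> U \<and> res F U V t \<in> left_orthogonal A F E \<Phi> V"
      unfolding left_kernel_def generated_submodule_def by auto
    interpret A: cring "sec A U" using U F.base.sec_cring by blast
    have "\<Phi> U t s = \<zero>\<^bsub>sec A U\<^esub>" if s: "s \<in> carrier (sec E U)" for s
    proof (rule F.base.section_eq_locally[OF U closed[OF U t s] A.zero_closed])
      fix x assume "x \<in> U"
      then obtain V where V: "openin T V" "x \<in> V" "V \<subseteq> U" "res F U V t \<in> left_orthogonal A F E \<Phi> V"
        using loc by blast
      interpret h: ring_hom_cring "sec A U" "sec A V" "res A U V"
        using F.base.res_ring_hom_cring[OF U V(1,3)] .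
      have "res A U V (\<Phi> U t s) = res A U V \<zero>\<^bsub>sec A U\<^esub>"
        using natural[OF U V(1,3) t s] V(4) E.res_closed[OF U V(1,3) s]
        by (simp add: left_orthogonal_def)
      then show "\<exists>V. openin T V \<and> x \<in> V \<and> V \<subseteq> U \<and> res A U V (\<Phi> U t s) = res A U V \<zero>\<^bsub>sec A U\<^esub>"
        using V by blast
    qed
    then show "t \<in> left_orthogonal A F E \<Phi> U" using t by (simp add: left_orthogonal_def)
  qed
qed

lemma left_orthogonal_submodule:
  assumes U: "openin T U"
  shows "submodule (left_orthogonal A F E \<Phi> U) (sec A U) (sec F U)"
proof -
  interpret A: cring "sec A U" using U F.base.sec_cring by blast
  interpret F': module "sec A U" "sec F U" using U F.sec_module by blast
  show ?thesis
  proof (rule F'.submoduleI)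
    show "\<zero>\<^bsub>sec F U\<^esub> \<in> left_orthogonal A F E \<Phi> U"
      using zero_left[OF U] by (simp add: left_orthogonal_def)
    fix a assume a: "a \<in> left_orthogonal A F E \<Phi> U"
    then have a': "a \<in> carrier (sec F U)" by (simp add: left_orthogonal_def)
    have "\<ominus>\<^bsub>sec F U\<^esub> a = (\<ominus>\<^bsub>sec A U\<^esub> \<one>\<^bsub>sec A U\<^esub>) \<odot>\<^bsub>sec F U\<^esub> a"
      using a' by (simp add: F'.smult_l_minus)
    moreover have "(\<ominus>\<^bsub>sec A U\<^esub> \<one>\<^bsub>sec A U\<^esub>) \<odot>\<^bsub>sec F U\<^esub> a \<in> left_orthogonal A F E \<Phi> U"
      using a unfolding left_orthogonal_def by (simp add: smult_left[OF U])
    ultimately show "\<ominus>\<^bsub>sec F U\<^esub> a \<in> left_orthogonal A F E \<Phi> U" by simp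
  qed (auto simp: left_orthogonal_def add_left[OF U] smult_left[OF U])
qed

text \<open>
  Over the smaller set \<open>V\<close> the module \<open>E\<close> may have sections that do not extend to \<open>U\<close>, so stability
  under restriction can fail for general \<open>E\<close>. For free \<open>E\<close> it is enough to test against the global
  generators, and those are already defined over \<open>U\<close>.
\<close>

lemma left_orthogonal_res:
  assumes free: "free_of_rank T A E n" and U: "openin T U" and V: "openin T V" "V \<subseteq> U"
    and t: "t \<in> left_orthogonal A F E \<Phi> U"
  shows "res F U V t \<in> left_orthogonal A F E \<Phi> V"
proof -
  obtain e where e: "\<And>j. e j \<in> carrier (sec E (topspace T))"
    and gen: "\<And>U h s. \<lbrakk>openin T U; linear_form (sec A U) (sec E U) h;
      \<And>j. j < n \<Longrightarrow> h (res E (topspace T) U (e j)) = \<zero>\<^bsub>sec A U\<^esub>; s \<in> carrier (sec E U)\<rbrakk>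
      \<Longrightarrow> h s = \<zero>\<^bsub>sec A U\<^esub>"
    using F.base.free_generators[OF free] by blast
  have tc: "t \<in> carrier (sec F U)" using t by (simp add: left_orthogonal_def)
  have rt: "res F U V t \<in> carrier (sec F V)" using F.res_closed[OF U V tc] .
  interpret h: ring_hom_cring "sec A U" "sec A V" "res A U V"
    using F.base.res_ring_hom_cring[OF U V] .
  have "\<Phi> V (res F U V t) s = \<zero>\<^bsub>sec A V\<^esub>" if s: "s \<in> carrier (sec E V)" for s
  proof (rule gen[OF V(1) linear_form_right[OF V(1) rt] _ s])
    fix j
    have ej: "res E (topspace T) U (e j) \<in> carrier (sec E U)"
      using E.res_closed[OF openin_topspace U openin_subset[OF U] e] .
    have "\<Phi> V (res F U V t) (res E (topspace T) V (e j)) =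
        \<Phi> V (res F U V t) (res E U V (res E (topspace T) U (e j)))"
      using E.res_comp[OF openin_topspace U V(1,2) openin_subset[OF U] e] by simp
    also have "\<dots> = res A U V (\<Phi> U t (res E (topspace T) U (e j)))"
      using natural[OF U V tc ej] by simp
    also have "\<dots> = \<zero>\<^bsub>sec A V\<^esub>" using t ej by (simp add: left_orthogonal_def)
    finally show "\<Phi> V (res F U V t) (res E (topspace T) V (e j)) = \<zero>\<^bsub>sec A V\<^esub>" .
  qed
  then show ?thesis using rt by (simp add: left_orthogonal_def)
qed

lemma module_subpresheaf_left_kernel:
  assumes "free_of_rank T A E n"
  shows "module_subpresheaf T A F (left_kernel T A F E \<Phi>)"
  using left_orthogonal_submodule left_orthogonal_res[OF assms]
  by (intro module_subpresheaf.intro module_subpresheaf_axioms.intro F.presheaf.presheaf_of_modules_axioms)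
    (simp_all add: left_kernel_eq_orthogonal)

text \<open>
  If \<open>n < m\<close>, the \<open>n\<close> equations \<open>\<Phi>(t, e i) = 0\<close> in the \<open>m\<close> coordinates of a global section \<open>t\<close> of \<open>F\<close>
  have a nonzero solution, which is a nonzero element of the left kernel.
\<close>

lemma rank_le:
  assumes F: "free_of_rank T A F m" and E: "free_of_rank T A E n"
    and inj: "left_kernel T A F E \<Phi> (topspace T) = {\<zero>\<^bsub>sec F (topspace T)\<^esub>}"
    and nontriv: "\<one>\<^bsub>sec A (topspace T)\<^esub> \<noteq> \<zero>\<^bsub>sec A (topspace T)\<^esub>"
  shows "m \<le> n"
proof (rule ccontr)
  assume "\<not> m \<le> n"
  let ?X = "topspace T"
  let ?R = "sec A ?X"
  have X: "openin T ?X" by simp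
  interpret R: cring ?R using X by (rule F.base.sec_cring)
  obtain e where e: "\<And>j. e j \<in> carrier (sec E ?X)"
    and gen: "\<And>U h s. \<lbrakk>openin T U; linear_form (sec A U) (sec E U) h;
      \<And>j. j < n \<Longrightarrow> h (res E ?X U (e j)) = \<zero>\<^bsub>sec A U\<^esub>; s \<in> carrier (sec E U)\<rbrakk>
      \<Longrightarrow> h s = \<zero>\<^bsub>sec A U\<^esub>"
    using F.base.free_generators[OF E] by blast
  have "sheaf_isomorphic T A F (free_sheaf A m)" using F by (simp add: free_of_rank_def)
  then obtain \<phi> \<psi> where \<phi>: "sheaf_morphism T A F (free_sheaf A m) \<phi>"
    and \<psi>: "sheaf_morphism T A (free_sheaf A m) F \<psi>"
    and inv': "\<And>U v. \<lbrakk>openin T U; v \<in> carrier (sec (free_sheaf A m) U)\<rbrakk> \<Longrightarrow> \<phi> U (\<psi> U v) = v"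
    by (rule sheaf_isomorphicE) (rule that)
  note inv = inv'[OF X, unfolded carrier_free_sheaf]
  have \<psi>c: "\<psi> ?X v \<in> carrier (sec F ?X)" if "v \<in> {..<m} \<rightarrow>\<^sub>E carrier ?R" for v
    using sheaf_morphism_closed[OF \<psi> X] that unfolding carrier_free_sheaf .
  let ?f = "\<lambda>j. \<psi> ?X (unit_vector ?R m j)"
  have f: "?f j \<in> carrier (sec F ?X)" for j using \<psi>c R.unit_vector_closed by blast
  have "\<exists>v\<in>{..<m} \<rightarrow> carrier ?R.
      (\<forall>i\<in>{..<n}. (\<Oplus>\<^bsub>?R\<^esub>j\<in>{..<m}. \<Phi> ?X (?f j) (e i) \<otimes>\<^bsub>?R\<^esub> v j) = \<zero>\<^bsub>?R\<^esub>) \<and>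
      (\<exists>j\<in>{..<m}. v j \<noteq> \<zero>\<^bsub>?R\<^esub>)"
    using \<open>\<not> m \<le> n\<close> nontriv closed[OF X f e] by (intro R.underdetermined_system) auto
  then obtain v where v: "v \<in> {..<m} \<rightarrow> carrier ?R"
    and sol: "\<And>i. i < n \<Longrightarrow> (\<Oplus>\<^bsub>?R\<^esub>j\<in>{..<m}. \<Phi> ?X (?f j) (e i) \<otimes>\<^bsub>?R\<^esub> v j) = \<zero>\<^bsub>?R\<^esub>"
    and nz: "\<exists>j<m. v j \<noteq> \<zero>\<^bsub>?R\<^esub>" by blast
  define w where "w = restrict v {..<m}"
  have w: "w \<in> {..<m} \<rightarrow>\<^sub>E carrier ?R" using v by (auto simp: w_def)
  have vc: "v j \<in> carrier ?R" if "j < m" for j using v that by auto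
  have "\<Phi> ?X (\<psi> ?X w) s = \<zero>\<^bsub>?R\<^esub>" if s: "s \<in> carrier (sec E ?X)" for s
  proof (rule gen[OF X linear_form_right[OF X \<psi>c[OF w]] _ s])
    fix i assume i: "i < n"
    have "\<Phi> ?X (\<psi> ?X w) (e i) = (\<Oplus>\<^bsub>?R\<^esub>j\<in>{..<m}. w j \<otimes>\<^bsub>?R\<^esub> \<Phi> ?X (?f j) (e i))"
      by (rule F.base.linear_form_free_expansion[OF X \<psi> linear_form_left[OF X e] w])
    also have "\<dots> = (\<Oplus>\<^bsub>?R\<^esub>j\<in>{..<m}. \<Phi> ?X (?f j) (e i) \<otimes>\<^bsub>?R\<^esub> v j)"
    proof (rule R.finsum_cong')
      fix j assume "j \<in> {..<m}"
      then show "w j \<otimes>\<^bsub>?R\<^esub> \<Phi> ?X (?f j) (e i) = \<Phi> ?X (?f j) (e i) \<otimes>\<^bsub>?R\<^esub> v j"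
        using vc[of j] closed[OF X f[of j] e[of i]] by (simp add: w_def R.m_comm)
    qed (use vc closed[OF X f e] in auto)
    finally show "\<Phi> ?X (\<psi> ?X w) (res E ?X ?X (e i)) = \<zero>\<^bsub>?R\<^esub>"
      using sol[OF i] E.res_id[OF X e] by simp
  qed
  then have "\<psi> ?X w \<in> left_orthogonal A F E \<Phi> ?X"
    using \<psi>c[OF w] by (simp add: left_orthogonal_def)
  then have "\<psi> ?X w = \<zero>\<^bsub>sec F ?X\<^esub>" using inj left_kernel_eq_orthogonal[OF X] by simp
  moreover interpret F': module ?R "sec F ?X" using X by (rule F.sec_module)
  \<comment> \<open>Writing zero as \<open>0\<close> times a section carries it through \<open>\<phi>\<close> by homogeneity alone.\<close>
  have "\<psi> ?X w = \<zero>\<^bsub>?R\<^esub> \<odot>\<^bsub>sec F ?X\<^esub> \<psi> ?X w" using calculation by simp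
  then have "\<phi> ?X (\<psi> ?X w) = \<zero>\<^bsub>?R\<^esub> \<odot>\<^bsub>sec (free_sheaf A m) ?X\<^esub> \<phi> ?X (\<psi> ?X w)"
    using sheaf_morphism_smult[OF \<phi> X R.zero_closed \<psi>c[OF w]] by simp
  then have "w = \<zero>\<^bsub>?R\<^esub> \<odot>\<^bsub>sec (free_sheaf A m) ?X\<^esub> w" using inv[OF w] by simp
  then have weq: "w = (\<lambda>i\<in>{..<m}. \<zero>\<^bsub>?R\<^esub> \<otimes>\<^bsub>?R\<^esub> w i)" by (simp add: free_sheaf_def)
  have "v j = \<zero>\<^bsub>?R\<^esub>" if j: "j < m" for j
    using fun_cong[OF weq, of j] j vc[OF j] by (simp add: w_def)
  then show False using nz by blast
qed

lemma right_kernel_flip: "right_kernel T A F E \<Phi> = left_kernel T A E F (\<lambda>U s t. \<Phi> U t s)"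
  unfolding right_kernel_def left_kernel_def
  by (intro arg_cong[where f = "generated_submodule T E"])
    (simp add: fun_eq_iff right_orthogonal_def left_orthogonal_def)

end

lemma induced_pairing_flip:
  "induced_pairing T A E F (\<lambda>U s t. \<Phi> U t s) = (\<lambda>U \<tau> \<sigma>. induced_pairing T A F E \<Phi> U \<sigma> \<tau>)"
proof -
  have orthogonal: "left_orthogonal A E F (\<lambda>U s t. \<Phi> U t s) = right_orthogonal A F E \<Phi>"
    "right_orthogonal A E F (\<lambda>U s t. \<Phi> U t s) = left_orthogonal A F E \<Phi>"
    by (simp_all add: fun_eq_iff right_orthogonal_def left_orthogonal_def)
  have coset_values: "(\<exists>s\<in>D. \<exists>t\<in>C. a = \<Phi> U t s) = (\<exists>t\<in>C. \<exists>s\<in>D. a = \<Phi> U t s)" for C D U a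
    by blast
  show ?thesis
    unfolding induced_pairing_def left_kernel_def right_kernel_def orthogonal coset_values
    by (intro ext sheafified_pairing_flip)
qed

section \<open>Pairings of free sheaves\<close>

locale free_pairing = pairing +
  assumes F_free: "\<exists>m. free_of_rank T A F m" and E_free: "\<exists>n. free_of_rank T A E n"
begin

abbreviation K where "K \<equiv> left_kernel T A F E \<Phi>"
abbreviation L where "L \<equiv> right_kernel T A F E \<Phi>"
abbreviation \<Phi>' where "\<Phi>' \<equiv> induced_pairing T A F E \<Phi>"

lemma flip_free: "free_pairing T A E F (\<lambda>U s t. \<Phi> U t s)"
  using flip F_free E_free by (intro free_pairing.intro free_pairing_axioms.intro)

text \<open>
  The rank bound in both directions. The zero ring is treated separately because over it the rank of
  a free module is not determined.
\<close>

theorem nondegenerate_imp_isomorphic: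
  assumes nd: "nondegenerate T A F E \<Phi>"
  shows "sheaf_isomorphic T A F E"
proof (cases "\<one>\<^bsub>sec A (topspace T)\<^esub> = \<zero>\<^bsub>sec A (topspace T)\<^esub>")
  case True
  then show ?thesis
    using F.sections_trivial E.sections_trivial
    by (intro zero_sheaves_isomorphic F.module_sheaf_axioms E.module_sheaf_axioms) auto
next
  case False
  obtain m n where F: "free_of_rank T A F m" and E: "free_of_rank T A E n"
    using F_free E_free by blast
  interpret flip: pairing T A E F "\<lambda>U s t. \<Phi> U t s" by (rule flip)
  have "m \<le> n" using nd by (intro rank_le[OF F E _ False]) (simp add: nondegenerate_def)
  moreover have "n \<le> m"
    using nd by (intro flip.rank_le[OF E F _ False]) (simp add: nondegenerate_def right_kernel_flip)
  ultimately show ?thesis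
    using F E sheaf_isomorphic_trans sheaf_isomorphic_sym unfolding free_of_rank_def
    by (metis le_antisym)
qed

sublocale QF: module_subpresheaf T A F K
  using E_free module_subpresheaf_left_kernel by blast

sublocale QE: module_subpresheaf T A E L
  unfolding right_kernel_flip using F_free pairing.module_subpresheaf_left_kernel[OF flip] by blast

text \<open>
  The presheaf pairing from which the induced pairing is generated: the common value of \<open>\<Phi>\<close> on all
  representatives of two cosets.
\<close>

abbreviation (input) value_on_cosets where
  "value_on_cosets \<equiv> (\<lambda>U C D. THE a. \<exists>t\<in>C. \<exists>s\<in>D. a = \<Phi> U t s)"

lemma left_kernel_zero:
  "\<lbrakk>openin T U; k \<in> K U; s \<in> carrier (sec E U)\<rbrakk> \<Longrightarrow> \<Phi> U k s = \<zero>\<^bsub>sec A U\<^esub>"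
  by (simp add: left_kernel_eq_orthogonal left_orthogonal_def)

lemma right_kernel_zero:
  "\<lbrakk>openin T U; l \<in> L U; t \<in> carrier (sec F U)\<rbrakk> \<Longrightarrow> \<Phi> U t l = \<zero>\<^bsub>sec A U\<^esub>"
  using pairing.left_kernel_eq_orthogonal[OF flip] by (simp add: right_kernel_flip left_orthogonal_def)

lemma value_on_cosets_classes:
  assumes U: "openin T U" and t: "t \<in> carrier (sec F U)" and s: "s \<in> carrier (sec E U)"
  shows "value_on_cosets U (K U +>\<^bsub>sec F U\<^esub> t) (L U +>\<^bsub>sec E U\<^esub> s) = \<Phi> U t s"
proof (rule the_equality)
  show "\<exists>t'\<in>K U +>\<^bsub>sec F U\<^esub> t. \<exists>s'\<in>L U +>\<^bsub>sec E U\<^esub> s. \<Phi> U t s = \<Phi> U t' s'"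
    using QF.coset_self[OF U t] QE.coset_self[OF U s] by blast
  fix a assume "\<exists>t'\<in>K U +>\<^bsub>sec F U\<^esub> t. \<exists>s'\<in>L U +>\<^bsub>sec E U\<^esub> s. a = \<Phi> U t' s'"
  then obtain t' s' where ts: "t' \<in> K U +>\<^bsub>sec F U\<^esub> t" "s' \<in> L U +>\<^bsub>sec E U\<^esub> s" "a = \<Phi> U t' s'"
    by blast
  obtain k where k: "k \<in> K U" "k \<in> carrier (sec F U)" "t' = k \<oplus>\<^bsub>sec F U\<^esub> t"
    using QF.in_cosetE[OF U ts(1) t] .
  obtain l where l: "l \<in> L U" "l \<in> carrier (sec E U)" "s' = l \<oplus>\<^bsub>sec E U\<^esub> s"
    using QE.in_cosetE[OF U ts(2) s] .
  interpret A: cring "sec A U" using U by (rule F.base.sec_cring)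
  interpret E': module "sec A U" "sec E U" using U by (rule E.sec_module)
  show "a = \<Phi> U t s"
    using k l t s closed[OF U t s] left_kernel_zero[OF U k(1)] right_kernel_zero[OF U l(1) t]
    by (simp add: ts(3) add_left[OF U] add_right[OF U])
qed

sublocale PQ: presheaf_pairing T A QF.Q QE.Q value_on_cosets
proof (intro presheaf_pairing.intro presheaf_pairing_axioms.intro
    QF.quotient_presheaf_of_modules QE.quotient_presheaf_of_modules)
  fix U C D assume U: "openin T U" and C: "C \<in> carrier (sec QF.Q U)" and D: "D \<in> carrier (sec QE.Q U)"
  obtain t where t: "t \<in> carrier (sec F U)" "C = K U +>\<^bsub>sec F U\<^esub> t" using C by (rule QF.quotientE)
  obtain s where s: "s \<in> carrier (sec E U)" "D = L U +>\<^bsub>sec E U\<^esub> s" using D by (rule QE.quotientE)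
  interpret F': module "sec A U" "sec F U" using U by (rule F.sec_module)
  interpret E': module "sec A U" "sec E U" using U by (rule E.sec_module)
  show "value_on_cosets U C D \<in> carrier (sec A U)"
    unfolding t(2) s(2) value_on_cosets_classes[OF U t(1) s(1)] using closed[OF U t(1) s(1)] .
  {
    fix C' assume C': "C' \<in> carrier (sec QF.Q U)"
    obtain t' where t': "t' \<in> carrier (sec F U)" "C' = K U +>\<^bsub>sec F U\<^esub> t'"
      using C' by (rule QF.quotientE)
    show "value_on_cosets U (C \<oplus>\<^bsub>sec QF.Q U\<^esub> C') D =
        value_on_cosets U C D \<oplus>\<^bsub>sec A U\<^esub> value_on_cosets U C' D"
      unfolding t(2) s(2) t'(2) QF.quotient_add[OF U t(1) t'(1)]
      by (simp only: value_on_cosets_classes[OF U] t t' s F'.a_closed add_left[OF U])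
  }
  {
    fix D' assume D': "D' \<in> carrier (sec QE.Q U)"
    obtain s' where s': "s' \<in> carrier (sec E U)" "D' = L U +>\<^bsub>sec E U\<^esub> s'"
      using D' by (rule QE.quotientE)
    show "value_on_cosets U C (D \<oplus>\<^bsub>sec QE.Q U\<^esub> D') =
        value_on_cosets U C D \<oplus>\<^bsub>sec A U\<^esub> value_on_cosets U C D'"
      unfolding t(2) s(2) s'(2) QE.quotient_add[OF U s(1) s'(1)]
      by (simp only: value_on_cosets_classes[OF U] t s s' E'.a_closed add_right[OF U])
  }
  {
    fix a assume a: "a \<in> carrier (sec A U)"
    show "value_on_cosets U (a \<odot>\<^bsub>sec QF.Q U\<^esub> C) D = a \<otimes>\<^bsub>sec A U\<^esub> value_on_cosets U C D"
      unfolding t(2) s(2) QF.quotient_smult[OF U a t(1)]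
      by (simp only: value_on_cosets_classes[OF U] t s a F'.smult_closed smult_left[OF U])
    show "value_on_cosets U C (a \<odot>\<^bsub>sec QE.Q U\<^esub> D) = a \<otimes>\<^bsub>sec A U\<^esub> value_on_cosets U C D"
      unfolding t(2) s(2) QE.quotient_smult[OF U a s(1)]
      by (simp only: value_on_cosets_classes[OF U] t s a E'.smult_closed smult_right[OF U])
  }
  {
    fix V assume V: "openin T V" "V \<subseteq> U"
    show "res A U V (value_on_cosets U C D) =
        value_on_cosets V (res QF.Q U V C) (res QE.Q U V D)"
      unfolding t(2) s(2) QF.quotient_res[OF U V t(1)] QE.quotient_res[OF U V s(1)]
      by (simp only: value_on_cosets_classes[OF U t(1) s(1)] natural[OF U V t(1) s(1)]
        value_on_cosets_classes[OF V(1) F.res_closed[OF U V t(1)] E.res_closed[OF U V s(1)]])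
  }
qed

lemma induced_pairing_eq: "\<Phi>' = PQ.\<Psi>"
  by (simp add: induced_pairing_def)

theorem pairing_induced: "pairing T A (quotient_sheaf T A F K) (quotient_sheaf T A E L) \<Phi>'"
  unfolding induced_pairing_eq quotient_sheaf_def by (rule PQ.pairing_sheafification)

theorem induced_pairing_classes:
  assumes U: "openin T U" and t: "t \<in> carrier (sec F U)" and s: "s \<in> carrier (sec E U)"
  shows "\<Phi>' U (quotient_class T F K U t) (quotient_class T E L U s) = \<Phi> U t s"
  unfolding induced_pairing_eq quotient_class_def
    PQ.sheafified_pairing_to_sheafification[OF U QF.coset_closed[OF t] QE.coset_closed[OF s]]
  by (rule value_on_cosets_classes[OF U t s])

text \<open>
  A section of the quotient that is orthogonal to everything over \<open>U\<close> is represented near each point by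
  some \<open>t\<close> over a smaller set \<open>V\<close>. Orthogonality is known only against sections over \<open>U\<close>, but the
  classes of the global generators of \<open>E\<close> are such sections, and they suffice to show that \<open>t\<close> lies in
  the kernel over \<open>V\<close>.
\<close>

lemma left_kernel_induced:
  assumes U: "openin T U"
  shows "left_kernel T A (quotient_sheaf T A F K) (quotient_sheaf T A E L) \<Phi>' U =
    {\<zero>\<^bsub>sec (quotient_sheaf T A F K) U\<^esub>}"
proof -
  let ?F = "quotient_sheaf T A F K" and ?E = "quotient_sheaf T A E L"
  interpret I: pairing T A ?F ?E \<Phi>' by (rule pairing_induced)
  interpret F': module "sec A U" "sec ?F U" using U by (rule I.F.sec_module)
  interpret A: cring "sec A U" using U by (rule F.base.sec_cring)
  obtain n where n: "free_of_rank T A E n" using E_free by blast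
  obtain e where e: "\<And>j. e j \<in> carrier (sec E (topspace T))"
    and gen: "\<And>U h s. \<lbrakk>openin T U; linear_form (sec A U) (sec E U) h;
      \<And>j. j < n \<Longrightarrow> h (res E (topspace T) U (e j)) = \<zero>\<^bsub>sec A U\<^esub>; s \<in> carrier (sec E U)\<rbrakk>
      \<Longrightarrow> h s = \<zero>\<^bsub>sec A U\<^esub>"
    using F.base.free_generators[OF n] by blast
  have "\<sigma> = \<zero>\<^bsub>sec ?F U\<^esub>" if \<sigma>: "\<sigma> \<in> left_orthogonal A ?F ?E \<Phi>' U" for \<sigma>
  proof -
    have \<sigma>c: "\<sigma> \<in> carrier (sec PQ.P.S U)" and orth: "\<And>\<tau>. \<tau> \<in> carrier (sec PQ.Q.S U) \<Longrightarrow> PQ.\<Psi> U \<sigma> \<tau> = \<zero>\<^bsub>sec A U\<^esub>"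
      using \<sigma> by (auto simp: left_orthogonal_def quotient_sheaf_def induced_pairing_eq)
    have "\<sigma> = \<zero>\<^bsub>sec PQ.P.S U\<^esub>"
    proof (rule PQ.P.section_eqI)
      fix x assume "x \<in> U"
      then obtain V C where V: "x \<in> V" "V \<subseteq> U" and C: "PQ.P.represented \<sigma> V C"
        by (rule PQ.P.section_represented[OF \<sigma>c])
      have o: "openin T V" and Cc: "C \<in> carrier (sec QF.Q V)" using C by (auto simp: PQ.P.represented_def)
      obtain t where t: "t \<in> carrier (sec F V)" "C = K V +>\<^bsub>sec F V\<^esub> t"
        using Cc by (rule QF.quotientE)
      interpret h: ring_hom_cring "sec A U" "sec A V" "res A U V"
        using F.base.res_ring_hom_cring[OF U o V(2)] .
      have "\<Phi> V t s = \<zero>\<^bsub>sec A V\<^esub>" if s: "s \<in> carrier (sec E V)" for s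
      proof (rule gen[OF o linear_form_right[OF o t(1)] _ s])
        fix j
        let ?eU = "res E (topspace T) U (e j)" and ?eV = "res E (topspace T) V (e j)"
        have eU: "?eU \<in> carrier (sec E U)"
          using E.res_closed[OF openin_topspace U openin_subset[OF U] e] .
        have eV: "res E U V ?eU = ?eV"
          using E.res_comp[OF openin_topspace U o V(2) openin_subset[OF U] e] .
        have eVc: "?eV \<in> carrier (sec E V)" using E.res_closed[OF U o V(2) eU] eV by simp
        let ?D = "L U +>\<^bsub>sec E U\<^esub> ?eU"
        have D: "?D \<in> carrier (sec QE.Q U)" using eU by (rule QE.coset_closed)
        have "PQ.Q.represented (to_sheafification T QE.Q U ?D) V (res QE.Q U V ?D)"
          by (rule PQ.Q.represented_res[OF PQ.Q.represented_to_sheafification[OF U D] o V(2)])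
        then have D': "PQ.Q.represented (to_sheafification T QE.Q U ?D) V (L V +>\<^bsub>sec E V\<^esub> ?eV)"
          using QE.quotient_res[OF U o V(2) eU] eV by simp
        have Dc: "to_sheafification T QE.Q U ?D \<in> carrier (sec PQ.Q.S U)"
          using PQ.Q.to_sheafification_closed[OF U D] .
        have "\<Phi> V t ?eV = value_on_cosets V C (L V +>\<^bsub>sec E V\<^esub> ?eV)"
          unfolding t(2) by (rule value_on_cosets_classes[OF o t(1) eVc, symmetric])
        also have "\<dots> = res A U V (PQ.\<Psi> U \<sigma> (to_sheafification T QE.Q U ?D))"
          using PQ.sheafified_pairing_represented[OF U \<sigma>c Dc V(2) C D'] by (rule sym)
        also have "\<dots> = \<zero>\<^bsub>sec A V\<^esub>" unfolding orth[OF Dc] by simp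
        finally show "\<Phi> V t ?eV = \<zero>\<^bsub>sec A V\<^esub>" .
      qed
      then have "t \<in> K V" using t(1) o by (simp add: left_kernel_eq_orthogonal left_orthogonal_def)
      then have "C = \<zero>\<^bsub>sec QF.Q V\<^esub>" unfolding t(2) by (rule QF.coset_mem[OF o])
      then show "\<exists>V s. x \<in> V \<and> PQ.P.represented \<sigma> V s \<and> PQ.P.represented \<zero>\<^bsub>sec PQ.P.S U\<^esub> V s"
        using V C PQ.P.represented_zero[OF U o V(2)] by blast
    qed (rule PQ.P.section_extensional[OF \<sigma>c] PQ.P.section_extensional[OF PQ.P.zero_closed[OF U]])+
    then show ?thesis by (simp add: quotient_sheaf_def)
  qed
  moreover have "\<zero>\<^bsub>sec ?F U\<^esub> \<in> left_orthogonal A ?F ?E \<Phi>' U"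
    using I.zero_left[OF U] by (simp add: left_orthogonal_def)
  ultimately show ?thesis unfolding I.left_kernel_eq_orthogonal[OF U] by blast
qed

theorem nondegenerate_induced:
  "nondegenerate T A (quotient_sheaf T A F K) (quotient_sheaf T A E L) \<Phi>'"
  unfolding nondegenerate_def
proof (intro allI impI conjI left_kernel_induced)
  fix U assume U: "openin T U"
  interpret I: pairing T A "quotient_sheaf T A F K" "quotient_sheaf T A E L" \<Phi>' by (rule pairing_induced)
  interpret flip: free_pairing T A E F "\<lambda>U s t. \<Phi> U t s" by (rule flip_free)
  have L: "left_kernel T A E F (\<lambda>U s t. \<Phi> U t s) = L"
    by (rule right_kernel_flip[symmetric])
  show "right_kernel T A (quotient_sheaf T A F K) (quotient_sheaf T A E L) \<Phi>' U =
      {\<zero>\<^bsub>sec (quotient_sheaf T A E L) U\<^esub>}"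
    using flip.left_kernel_induced[OF U]
    unfolding induced_pairing_flip[of T A E F \<Phi>] L flip.right_kernel_flip I.right_kernel_flip .
qed

end

theorem theorem2p4:
  fixes T :: "'x topology" and A :: "('x, 'r) algebra_presheaf"
    and F :: "('x, 'r, 'f) module_presheaf" and E :: "('x, 'r, 'e) module_presheaf"
    and \<Phi> :: "'x set \<Rightarrow> 'f \<Rightarrow> 'e \<Rightarrow> 'r"
  assumes "algebraized_space T A"
    and "\<exists>m. free_of_rank T A F m"
    and "\<exists>n. free_of_rank T A E n"
    and "pairing T A F E \<Phi>"
  shows "(nondegenerate T A F E \<Phi> \<longrightarrow> sheaf_isomorphic T A F E) \<and>
    (\<not> nondegenerate T A F E \<Phi> \<longrightarrow>
      (let K = left_kernel T A F E \<Phi>; L = right_kernel T A F E \<Phi>;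
           F' = quotient_sheaf T A F K; E' = quotient_sheaf T A E L;
           \<Phi>' = induced_pairing T A F E \<Phi>
       in pairing T A F' E' \<Phi>' \<and>
          (\<forall>U t s. openin T U \<longrightarrow> t \<in> carrier (sec F U) \<longrightarrow> s \<in> carrier (sec E U) \<longrightarrow>
            \<Phi>' U (quotient_class T F K U t) (quotient_class T E L U s) = \<Phi> U t s) \<and>
          nondegenerate T A F' E' \<Phi>'))"
proof -
  interpret free_pairing T A F E \<Phi>
    using assms(2-4) by (intro free_pairing.intro free_pairing_axioms.intro)
  show ?thesis
    unfolding Let_def
    using nondegenerate_imp_isomorphic pairing_induced induced_pairing_classes nondegenerate_induced
    by blast
qed

end
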